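(* Let $\mathcal{U} \subseteq \mathcal{P}$ be a nonempty open set. Then there is a constant $c_2 = c_2(\mathcal{U}) > 0$ such that for every $\delta \in (0, 1/4]$ and for every sequence of estimators $\hat{a}_n : \Omega^n \to \mathbb{R}$, $n \in \mathbb{N}$, one has $$\liminf_{n \to \infty} \sup_{P \in \mathcal{U}} P^n\big[L_P(\hat{a}_n) > L_P(a(P)) + S n^{-2/3}\big] \geq \delta,$$ where $S = S(\mathcal{U}, \delta) := c_2 |\log(11\delta)|^{2/3}$.
   Context: Let $\Omega = [0,1] \times \{\pm 1\}$ with the Borel $\sigma$-field. Let $\tilde{\mathcal{P}}$ be the set of all probability measures $P$ on $\Omega$ having a density $f_P \in C^1([0,1]\times\{\pm 1\})$ with respect to (Lebesgue measure on $[0,1]$) $\otimes$ (counting measure on $\{\pm1\}$). Write $f_P^+ := f_P(\cdot,1)$ and $f_P^- := f_P(\cdot,-1)$. Endow $\tilde{\mathcal{P}}$ with the metric $d(P,Q) := \|f_P - f_Q\|_\infty + \|\partial_1 f_P - \partial_1 f_Q\|_\infty$, where $\partial_1$ is the derivative with respect to the first argument. Let $\mathcal{P} \subseteq \tilde{\mathcal{P}}$ be the set of all $P \in \tilde{\mathcal{P}}$ such that there is a unique point $a(P) \in [0,1]$ with $f_P^+(a(P)) = f_P^-(a(P))$, this point lies in the open interval $(0,1)$, and $(f_P^+)'(a(P)) > (f_P^-)'(a(P))$. $\mathcal{P}$ carries the topology induced by $d$; "open" means open in $\mathcal{P}$. $P^n$ denotes the $n$-fold product measure of $P$ on $\Omega^n$.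 An estimator is a measurable function $\hat a_n:\Omega^n \to \mathbb{R}$. For $\alpha \in \mathbb{R}$ let $h_\alpha(x) := 1$ if $x \geq \alpha$ and $h_\alpha(x) := -1$ if $x < \alpha$. The prediction error is $L_P(\alpha) := P[h_\alpha(X) \neq Y]$, where $(X,Y)$ is the identity (coordinate pair) on $\Omega$, distributed according to $P$. $L_P(\hat a_n)$ denotes the composition of the function $L_P$ with $\hat a_n$. *)

theory Defs
  imports "HOL-Probability.Probability"
begin

definition Omega :: "(real \<times> int) set" where
  "Omega = {0..1} \<times> {-1, 1}"

definition ref_measure :: "(real \<times> int) measure" where
  "ref_measure = restrict_space lborel {0..1} \<Otimes>\<^sub>M count_space {-1, 1}"

definition C1_unit :: "(real \<Rightarrow> real) \<Rightarrow> bool" where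
  "C1_unit g \<longleftrightarrow>
     (\<exists>g'. (\<forall>x\<in>{0..1}. (g has_real_derivative g' x) (at x within {0..1}))
         \<and> continuous_on {0..1} g')"

definition is_C1_density :: "(real \<times> int) measure \<Rightarrow> (real \<times> int \<Rightarrow> real) \<Rightarrow> bool" where
  "is_C1_density P f \<longleftrightarrow>
     (\<forall>w\<in>Omega. 0 \<le> f w) \<and> (\<forall>y\<in>{-1, 1}. C1_unit (\<lambda>x. f (x, y)))
     \<and> P = density ref_measure (\<lambda>w. ennreal (f w))"

definition P_tilde :: "(real \<times> int) measure set" where
  "P_tilde = {P. prob_space P \<and> (\<exists>f. is_C1_density P f)}"

(* The C^1 density of P is unique on Omega (is_C1_density_unique); the values of the
   chosen f elsewhere are never used.  The value 0 outside P_tilde only serves to make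
   C1_dist nonnegative on the whole type, as the locale Metric_space requires. *)
definition dens :: "(real \<times> int) measure \<Rightarrow> real \<times> int \<Rightarrow> real" where
  "dens P = (if P \<in> P_tilde then SOME f. is_C1_density P f else (\<lambda>_. 0))"

definition dens_deriv :: "(real \<times> int) measure \<Rightarrow> real \<times> int \<Rightarrow> real" where
  "dens_deriv P = (\<lambda>(x, y). vector_derivative (\<lambda>t. dens P (t, y)) (at x within {0..1}))"

definition C1_dist :: "(real \<times> int) measure \<Rightarrow> (real \<times> int) measure \<Rightarrow> real" where
  "C1_dist P Q =
     (SUP w\<in>Omega. \<bar>dens P w - dens Q w\<bar>) + (SUP w\<in>Omega. \<bar>dens_deriv P w - dens_deriv Q w\<bar>)"

definition crossing :: "(real \<times> int) measure \<Rightarrow> real \<Rightarrow> bool" where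
  "crossing P a \<longleftrightarrow> a \<in> {0..1} \<and> dens P (a, 1) = dens P (a, -1)"

definition cross_pt :: "(real \<times> int) measure \<Rightarrow> real" where
  "cross_pt P = (THE a. crossing P a)"

definition P_class :: "(real \<times> int) measure set" where
  "P_class = {P \<in> P_tilde. (\<exists>!a. crossing P a) \<and> cross_pt P \<in> {0<..<1}
                \<and> dens_deriv P (cross_pt P, 1) > dens_deriv P (cross_pt P, -1)}"

definition P_topology :: "(real \<times> int) measure topology" where
  "P_topology = subtopology (Metric_space.mtopology P_tilde C1_dist) P_class"

definition classifier :: "real \<Rightarrow> real \<Rightarrow> int" where
  "classifier \<alpha> x = (if x \<ge> \<alpha> then 1 else -1)"

definition pred_error :: "(real \<times> int) measure \<Rightarrow> real \<Rightarrow> real" where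
  "pred_error P \<alpha> = measure P {w \<in> space P. classifier \<alpha> (fst w) \<noteq> snd w}"

definition npower :: "nat \<Rightarrow> 'a measure \<Rightarrow> (nat \<Rightarrow> 'a) measure" where
  "npower n M = (\<Pi>\<^sub>M i\<in>{..<n}. M)"

(* Only the measurable space underlying npower n ref_measure matters here: it is
   Omega^n with the product of the Borel sigma-fields (space_ref_measure, sets_ref_measure). *)
definition estimator :: "nat \<Rightarrow> ((nat \<Rightarrow> real \<times> int) \<Rightarrow> real) \<Rightarrow> bool" where
  "estimator n ah \<longleftrightarrow> ah \<in> borel_measurable (npower n ref_measure)"

lemma space_ref_measure: "space ref_measure = Omega"
  by (auto simp: ref_measure_def Omega_def space_pair_measure space_restrict_space)

lemma sets_ref_measure: "sets ref_measure = sets (restrict_space borel Omega)"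
proof -
  let ?R = "restrict_space borel {0..1::real}"
  let ?C = "count_space {-1, 1::int}"
  have eq: "sets ref_measure = sets (?R \<Otimes>\<^sub>M ?C)"
    unfolding ref_measure_def by (intro sets_pair_measure_cong sets_restrict_space_cong) auto
  have sp: "space (?R \<Otimes>\<^sub>M ?C) = Omega"
    by (auto simp: Omega_def space_pair_measure space_restrict_space)
  have cnt: "?C = restrict_space (count_space UNIV) {-1, 1}"
    by (simp add: restrict_count_space)
  have m1: "(\<lambda>x. x) \<in> ?R \<Otimes>\<^sub>M ?C \<rightarrow>\<^sub>M restrict_space borel Omega"
  proof (rule measurable_restrict_space2)
    show "(\<lambda>x. x) \<in> borel_measurable (?R \<Otimes>\<^sub>M ?C)"
    proof (rule borel_measurableI)
      fix S :: "(real \<times> int) set" assume S: "open S"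
      have "{x. (x, y) \<in> S} \<inter> {0..1} \<in> sets ?R" for y
      proof -
        have "open ((\<lambda>x. (x, y)) -` S)"
          by (intro open_vimage S continuous_intros)
        then show ?thesis
          by (auto simp: sets_restrict_space vimage_def Int_commute)
      qed
      then have "(\<Union>y\<in>{-1, 1}. ({x. (x, y) \<in> S} \<inter> {0..1}) \<times> {y}) \<in> sets (?R \<Otimes>\<^sub>M ?C)"
        by (intro sets.finite_UN pair_measureI) auto
      also have "(\<Union>y\<in>{-1, 1}. ({x. (x, y) \<in> S} \<inter> {0..1}) \<times> {y})
          = (\<lambda>x. x) -` S \<inter> space (?R \<Otimes>\<^sub>M ?C)"
        unfolding sp by (auto simp: Omega_def)
      finally show "(\<lambda>x. x) -` S \<inter> space (?R \<Otimes>\<^sub>M ?C) \<in> sets (?R \<Otimes>\<^sub>M ?C)" .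
    qed
  qed (simp add: sp)
  have m2: "(\<lambda>x. x) \<in> restrict_space borel Omega \<rightarrow>\<^sub>M ?R \<Otimes>\<^sub>M ?C"
  proof (rule measurable_pair)
    have "fst \<in> restrict_space borel Omega \<rightarrow>\<^sub>M ?R"
      by (rule measurable_restrict_space2)
        (auto simp: Omega_def space_restrict_space
          intro!: borel_measurable_continuous_on_restrict continuous_intros)
    then show "fst \<circ> (\<lambda>x. x) \<in> restrict_space borel Omega \<rightarrow>\<^sub>M ?R" by (simp add: comp_def)
    have "snd \<in> restrict_space borel Omega \<rightarrow>\<^sub>M (borel :: int measure)"
      by (intro borel_measurable_continuous_on_restrict continuous_intros)
    then have "snd \<in> restrict_space borel Omega \<rightarrow>\<^sub>M count_space (UNIV :: int set)"
      using measurable_cong_sets[OF refl sets_borel_eq_count_space] by blast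
    then have "snd \<in> restrict_space borel Omega \<rightarrow>\<^sub>M ?C"
      unfolding cnt by (intro measurable_restrict_space2) (auto simp: Omega_def space_restrict_space)
    then show "snd \<circ> (\<lambda>x. x) \<in> restrict_space borel Omega \<rightarrow>\<^sub>M ?C" by (simp add: comp_def)
  qed
  have "A \<in> sets (?R \<Otimes>\<^sub>M ?C)" if "A \<in> sets (restrict_space borel Omega)" for A
  proof -
    have "A \<subseteq> Omega" using sets.sets_into_space[OF that] by (simp add: space_restrict_space)
    then show ?thesis using measurable_sets[OF m1 that] by (simp add: sp Int_absorb2)
  qed
  moreover have "A \<in> sets (restrict_space borel Omega)" if "A \<in> sets (?R \<Otimes>\<^sub>M ?C)" for A
  proof -
    have "A \<subseteq> Omega" using sets.sets_into_space[OF that] by (simp add: sp)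
    then show ?thesis
      using measurable_sets[OF m2 that] by (simp add: space_restrict_space Int_absorb2)
  qed
  ultimately show ?thesis using eq by blast
qed

lemma C1_unit_continuous: "C1_unit g \<Longrightarrow> continuous_on {0..1} g"
  unfolding C1_unit_def by (meson DERIV_continuous_on)

lemma is_C1_density_continuous: "is_C1_density P f \<Longrightarrow> continuous_on Omega f"
proof -
  assume a: "is_C1_density P f"
  have c: "continuous_on ({0..1} \<times> {y}) f" if "y \<in> {-1, 1}" for y
  proof -
    have 1: "continuous_on {0..1} (\<lambda>x. f (x, y))"
      using a that C1_unit_continuous unfolding is_C1_density_def by blast
    have "continuous_on ({0..1} \<times> {y}) (\<lambda>w. f (fst w, y))"
      by (rule continuous_on_compose2[OF 1]) (auto intro!: continuous_intros)
    then show ?thesis by (rule continuous_on_eq) auto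
  qed
  have "continuous_on ({0..1} \<times> {-1} \<union> {0..1} \<times> {1}) f"
    by (intro continuous_on_closed_Un c closed_Times) auto
  also have "{0..1} \<times> {-1} \<union> {0..1} \<times> {1} = Omega" by (auto simp: Omega_def)
  finally show ?thesis .
qed

lemma is_C1_density_measurable: "is_C1_density P f \<Longrightarrow> f \<in> borel_measurable ref_measure"
  using borel_measurable_continuous_on_restrict[OF is_C1_density_continuous]
    measurable_cong_sets[OF sets_ref_measure refl] by blast

lemma is_C1_density_unique:
  assumes f: "is_C1_density P f" and g: "is_C1_density P g" and w: "w \<in> Omega"
  shows "f w = g w"
proof -
  obtain x y where wxy: "w = (x, y)" "x \<in> {0..1}" "y \<in> {-1, 1}"
    using w by (auto simp: Omega_def)
  let ?R = "restrict_space lborel {0..1::real}"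
  let ?C = "count_space {-1, 1::int}"
  interpret R: sigma_finite_measure ?R
    by (rule sigma_finite_measure_restrict_space) (auto intro: sigma_finite_lborel)
  interpret C: sigma_finite_measure ?C
    by (rule sigma_finite_measure_count_space_finite) simp
  interpret RC: pair_sigma_finite ?R ?C ..
  have "AE w in ?R \<Otimes>\<^sub>M ?C. ennreal (f w) = ennreal (g w)"
    using f g RC.density_unique_iff[of "\<lambda>w. ennreal (f w)" "\<lambda>w. ennreal (g w)"]
      is_C1_density_measurable[OF f] is_C1_density_measurable[OF g]
    unfolding is_C1_density_def ref_measure_def by auto
  from RC.AE_pair[OF this]
  have "AE x in lborel. x \<in> {0..1} \<longrightarrow> (\<forall>y\<in>{-1,1}. ennreal (f (x, y)) = ennreal (g (x, y)))"
    unfolding AE_count_space by (subst (asm) AE_restrict_space_iff) auto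
  then have "AE x in lborel. x \<in> {0<..<1} \<longrightarrow> x \<in> {x\<in>{0..1}. f (x, y) - g (x, y) = 0}"
  proof eventually_elim
    case (elim x)
    then show ?case
      using f g wxy(3) by (auto simp: is_C1_density_def Omega_def)
  qed
  then have ae: "AE x \<in> {0<..<1} in lebesgue. x \<in> {x\<in>{0..1}. f (x, y) - g (x, y) = 0}"
    by (rule AE_completion)
  have cf: "continuous_on {0..1} (\<lambda>x. f (x, y) - g (x, y))"
    using f g wxy(3) C1_unit_continuous unfolding is_C1_density_def
    by (intro continuous_intros) auto
  then have cl: "closed {x\<in>{0..1}. f (x, y) - g (x, y) = 0}"
    using continuous_closed_preimage_constant[OF cf, of 0] by simp
  have "{0<..<1} \<subseteq> {x\<in>{0..1}. f (x, y) - g (x, y) = 0}"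
    using mem_closed_if_AE_lebesgue_open[OF open_greaterThanLessThan cl ae] by blast
  then have "closure {0<..<1} \<subseteq> {x\<in>{0..1}. f (x, y) - g (x, y) = 0}"
    by (rule closure_minimal[OF _ cl])
  moreover have "x \<in> closure {0<..<1}" using wxy(2) by simp
  ultimately have "x \<in> {x\<in>{0..1}. f (x, y) - g (x, y) = 0}" by (rule subsetD)
  then show ?thesis using wxy(1) by simp
qed

lemma is_C1_density_dens: "P \<in> P_tilde \<Longrightarrow> is_C1_density P (dens P)"
  unfolding dens_def P_tilde_def using someI_ex[of "is_C1_density P"] by simp

lemma dens_deriv_continuous:
  assumes y: "y \<in> {-1, 1}"
  shows "continuous_on {0..1} (\<lambda>x. dens P (x, y))" "continuous_on {0..1} (\<lambda>x. dens_deriv P (x, y))"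
proof -
  have "C1_unit (\<lambda>x. dens P (x, y))"
  proof (cases "P \<in> P_tilde")
    case True
    then show ?thesis using is_C1_density_dens y unfolding is_C1_density_def by blast
  next
    case False
    then show ?thesis by (auto simp: dens_def C1_unit_def intro!: exI[of _ "\<lambda>_. 0"])
  qed
  then obtain g' where g': "\<forall>x\<in>{0..1}. ((\<lambda>x. dens P (x, y)) has_real_derivative g' x) (at x within {0..1})"
    "continuous_on {0..1} g'" and c: "continuous_on {0..1} (\<lambda>x. dens P (x, y))"
    using C1_unit_continuous unfolding C1_unit_def by blast
  show "continuous_on {0..1} (\<lambda>x. dens P (x, y))" by (rule c)
  have "dens_deriv P (x, y) = g' x" if "x \<in> {0..1}" for x
    unfolding dens_deriv_def using that g'(1)
    by (auto simp: has_real_derivative_iff_has_vector_derivative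
        intro!: vector_derivative_within_closed_interval)
  then show "continuous_on {0..1} (\<lambda>x. dens_deriv P (x, y))"
    using g'(2) by (subst continuous_on_cong[OF refl])
qed

lemma bdd_above_Omega:
  fixes u :: "real \<times> int \<Rightarrow> real"
  assumes "\<And>y. y \<in> {-1, 1} \<Longrightarrow> continuous_on {0..1} (\<lambda>x. u (x, y))"
  shows "bdd_above (u ` Omega)"
proof -
  have "bdd_above ((\<lambda>x. u (x, y)) ` {0..1})" if "y \<in> {-1, 1}" for y
    by (intro bounded_imp_bdd_above compact_imp_bounded compact_continuous_image assms that) simp
  moreover have "u ` Omega = (\<lambda>x. u (x, -1)) ` {0..1} \<union> (\<lambda>x. u (x, 1)) ` {0..1}"
    by (auto simp: Omega_def)
  ultimately show ?thesis by simp
qed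

lemma C1_dist_bdd:
  "bdd_above ((\<lambda>w. \<bar>dens P w - dens Q w\<bar>) ` Omega)"
  "bdd_above ((\<lambda>w. \<bar>dens_deriv P w - dens_deriv Q w\<bar>) ` Omega)"
  by (intro bdd_above_Omega continuous_intros dens_deriv_continuous; assumption)+

lemma Omega_nonempty: "Omega \<noteq> {}"
  by (auto simp: Omega_def)

lemma SUP_abs_nonneg:
  fixes u :: "'a \<Rightarrow> real"
  assumes "bdd_above ((\<lambda>w. \<bar>u w\<bar>) ` A)" "A \<noteq> {}"
  shows "0 \<le> (SUP w\<in>A. \<bar>u w\<bar>)"
proof -
  obtain w where "w \<in> A" using assms(2) by blast
  from cSUP_upper[OF this assms(1)] show ?thesis by (meson abs_ge_zero order_trans)
qed

lemma SUP_abs_triangle: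
  fixes p q r :: "'a \<Rightarrow> real"
  assumes "bdd_above ((\<lambda>w. \<bar>p w - q w\<bar>) ` A)" "bdd_above ((\<lambda>w. \<bar>q w - r w\<bar>) ` A)" "A \<noteq> {}"
  shows "(SUP w\<in>A. \<bar>p w - r w\<bar>) \<le> (SUP w\<in>A. \<bar>p w - q w\<bar>) + (SUP w\<in>A. \<bar>q w - r w\<bar>)"
proof (rule cSUP_least[OF assms(3)])
  fix w assume "w \<in> A"
  from cSUP_upper[OF this assms(1)] cSUP_upper[OF this assms(2)]
  show "\<bar>p w - r w\<bar> \<le> (SUP w\<in>A. \<bar>p w - q w\<bar>) + (SUP w\<in>A. \<bar>q w - r w\<bar>)"
    by linarith
qed

interpretation P_tilde: Metric_space P_tilde C1_dist
proof
  show "0 \<le> C1_dist P Q" for P Q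
    unfolding C1_dist_def using C1_dist_bdd Omega_nonempty by (intro add_nonneg_nonneg SUP_abs_nonneg)
  show "C1_dist P Q = C1_dist Q P" for P Q
    unfolding C1_dist_def by (simp add: abs_minus_commute)
  show "C1_dist P R \<le> C1_dist P Q + C1_dist Q R" for P Q R
    using SUP_abs_triangle[OF C1_dist_bdd(1)[of P Q] C1_dist_bdd(1)[of Q R] Omega_nonempty]
      SUP_abs_triangle[OF C1_dist_bdd(2)[of P Q] C1_dist_bdd(2)[of Q R] Omega_nonempty]
    unfolding C1_dist_def by linarith
  show "C1_dist P Q = 0 \<longleftrightarrow> P = Q" if P: "P \<in> P_tilde" and Q: "Q \<in> P_tilde" for P Q
  proof
    assume d0: "C1_dist P Q = 0"
    have s0: "(SUP w\<in>Omega. \<bar>dens P w - dens Q w\<bar>) \<le> 0"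
      using d0 SUP_abs_nonneg[OF C1_dist_bdd(2)[of P Q] Omega_nonempty]
      unfolding C1_dist_def by linarith
    have eq: "dens P w = dens Q w" if "w \<in> Omega" for w
      using cSUP_upper[OF that C1_dist_bdd(1)[of P Q]] s0 by linarith
    have "P = density ref_measure (\<lambda>w. ennreal (dens P w))"
      using is_C1_density_dens[OF P] unfolding is_C1_density_def by blast
    also have "\<dots> = density ref_measure (\<lambda>w. ennreal (dens Q w))"
      using is_C1_density_measurable[OF is_C1_density_dens[OF P]]
        is_C1_density_measurable[OF is_C1_density_dens[OF Q]] eq
      by (intro density_cong AE_I2) (auto simp: space_ref_measure)
    also have "\<dots> = Q"
      using is_C1_density_dens[OF Q] unfolding is_C1_density_def by (elim conjE) (rule sym)
    finally show "P = Q" .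
  next
    assume "P = Q"
    then show "C1_dist P Q = 0" using Omega_nonempty by (simp add: C1_dist_def)
  qed
qed

lemma openin_P_topology:
  "openin P_topology U \<longleftrightarrow>
     U \<subseteq> P_class \<and> (\<forall>P\<in>U. \<exists>r>0. \<forall>Q\<in>P_class. C1_dist P Q < r \<longrightarrow> Q \<in> U)"
proof -
  have sub: "P_class \<subseteq> P_tilde" by (auto simp: P_class_def)
  interpret S: Submetric P_tilde C1_dist P_class
    by unfold_locales (rule sub)
  have top: "P_topology = S.sub.mtopology"
    unfolding P_topology_def by (simp add: S.mtopology_submetric)
  have ball: "S.sub.mball P r \<subseteq> U \<longleftrightarrow> (\<forall>Q\<in>P_class. C1_dist P Q < r \<longrightarrow> Q \<in> U)"
    if "P \<in> P_class" for P r
    using that by auto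
  have *: "openin P_topology U \<longleftrightarrow> U \<subseteq> P_class \<and> (\<forall>P. P \<in> U \<longrightarrow> (\<exists>r>0. S.sub.mball P r \<subseteq> U))"
    unfolding top by (rule S.sub.openin_mtopology)
  show ?thesis
    unfolding *
  proof (intro conj_cong refl)
    assume "U \<subseteq> P_class"
    then show "(\<forall>P. P \<in> U \<longrightarrow> (\<exists>r>0. S.sub.mball P r \<subseteq> U))
      \<longleftrightarrow> (\<forall>P\<in>U. \<exists>r>0. \<forall>Q\<in>P_class. C1_dist P Q < r \<longrightarrow> Q \<in> U)"
      using ball by (simp add: Ball_def subset_iff)
  qed
qed

end

theory Submission
  imports Defs
begin

text \<open>Le Cam's two-point method. Fix \<open>P \<in> U\<close> with optimal threshold \<open>a\<close>, and let \<open>Q\<close> have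
  the density \<open>f\<^sub>P(x, y) + y g(x)\<close>, where \<open>g\<close> is a \<open>C\<^sup>1\<close> bump of height \<open>\<epsilon> t\<close> and width
  \<open>2 t\<close> around \<open>a\<close>. For a small fixed \<open>\<epsilon>\<close>, \<open>Q\<close> stays in \<open>U\<close> as \<open>t\<close> tends to 0. The crossing
  point moves by a distance of order \<open>t\<close>, and the prediction error grows quadratically away from
  the crossing point, so every threshold has excess error of order \<open>t\<^sup>2\<close> under \<open>P\<close> or under
  \<open>Q\<close>. On the other hand the \<open>\<chi>\<^sup>2\<close>-divergence is of order \<open>t\<^sup>3\<close>, so for
  \<open>t = \<tau> n\<^bsup>-1/3\<^esup>\<close> the second moment of the likelihood ratio of \<open>n\<close> observations stays below
  \<open>exp (C \<tau>\<^sup>3)\<close>, and no test can separate \<open>P\<close> from \<open>Q\<close>.\<close>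

subsection \<open>Product measures and tests\<close>

text \<open>A finite product of sigma-finite measures is determined by its values on boxes, and over
  a box the integral of the product density factorises.\<close>

lemma npower_density:
  assumes M: "sigma_finite_measure M" and N: "sigma_finite_measure (density M f)"
    and f[measurable]: "f \<in> borel_measurable M"
  shows "npower n (density M f) = density (npower n M) (\<lambda>w. \<Prod>i<n. f (w i))"
proof -
  interpret pM: product_sigma_finite "\<lambda>_::nat. M" using M by unfold_locales (simp add: sigma_finite_measure_def)
  interpret pN: product_sigma_finite "\<lambda>_::nat. density M f"
    using N by unfold_locales (simp add: sigma_finite_measure_def)
  have "density (npower n M) (\<lambda>w. \<Prod>i<n. f (w i)) = (\<Pi>\<^sub>M i\<in>{..<n}. density M f)"
  proof (rule pN.PiM_eqI)
    show "sets (density (npower n M) (\<lambda>w. \<Prod>i<n. f (w i))) = sets (\<Pi>\<^sub>M i\<in>{..<n}. density M f)"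
      unfolding npower_def by (simp cong: sets_PiM_cong)
    fix A :: "nat \<Rightarrow> 'a set" assume "\<And>i. i \<in> {..<n} \<Longrightarrow> A i \<in> sets (density M f)"
    then have A[measurable]: "A i \<in> sets M" if "i < n" for i using that by simp
    have "emeasure (density (npower n M) (\<lambda>w. \<Prod>i<n. f (w i))) (Pi\<^sub>E {..<n} A)
        = (\<integral>\<^sup>+w. (\<Prod>i<n. f (w i)) * indicator (Pi\<^sub>E {..<n} A) w \<partial>npower n M)"
      unfolding npower_def by (subst emeasure_density) (auto intro!: sets_PiM_I_finite)
    also have "\<dots> = (\<integral>\<^sup>+w. (\<Prod>i<n. f (w i) * indicator (A i) (w i)) \<partial>npower n M)"
    proof (rule nn_integral_cong)
      fix w assume "w \<in> space (npower n M)"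
      \<comment> \<open>Sample points are extensional functions, so membership in the box reduces to
        membership in each factor.\<close>
      then have "w \<in> extensional {..<n}" by (auto simp: npower_def space_PiM PiE_def)
      then have "indicator (Pi\<^sub>E {..<n} A) w = (\<Prod>i<n. indicator (A i) (w i) :: ennreal)"
        by (auto simp: indicator_def PiE_def Pi_def)
      then show "(\<Prod>i<n. f (w i)) * indicator (Pi\<^sub>E {..<n} A) w
          = (\<Prod>i<n. f (w i) * indicator (A i) (w i))"
        by (simp add: prod.distrib)
    qed
    also have "\<dots> = (\<Prod>i<n. \<integral>\<^sup>+x. f x * indicator (A i) x \<partial>M)"
      unfolding npower_def by (rule pM.product_nn_integral_prod) auto
    also have "\<dots> = (\<Prod>i<n. emeasure (density M f) (A i))"
      by (intro prod.cong) (auto simp: emeasure_density)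
    finally show "emeasure (density (npower n M) (\<lambda>w. \<Prod>i<n. f (w i))) (Pi\<^sub>E {..<n} A)
      = (\<Prod>i\<in>{..<n}. emeasure (density M f) (A i))" .
  qed simp
  then show ?thesis by (simp add: npower_def)
qed

lemma prob_space_npower: "prob_space M \<Longrightarrow> prob_space (npower n M)"
  unfolding npower_def by (rule prob_space_PiM)

text \<open>Cauchy--Schwarz for the likelihood ratio; \<open>c\<close> bounds the \<open>\<chi>\<^sup>2\<close>-divergence of one observation.\<close>

lemma npower_density_chi_square:
  assumes M: "prob_space M" and N: "prob_space (density M f)"
    and f[measurable]: "f \<in> borel_measurable M"
    and c: "0 \<le> c" "(\<integral>\<^sup>+x. f x ^ 2 \<partial>M) \<le> ennreal (1 + c)"
    and E: "E \<in> sets (npower n M)"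
  shows "measure (npower n (density M f)) E ^ 2 \<le> measure (npower n M) E * (1 + c) ^ n"
proof -
  interpret pM: product_sigma_finite "\<lambda>_::nat. M"
    using prob_space_imp_sigma_finite[OF M] by unfold_locales (simp add: sigma_finite_measure_def)
  interpret Mn: prob_space "npower n M" by (rule prob_space_npower[OF M])
  interpret Nn: prob_space "npower n (density M f)" by (rule prob_space_npower[OF N])
  let ?F = "\<lambda>w. \<Prod>i<n. f (w i)"
  have F[measurable]: "?F \<in> borel_measurable (npower n M)"
    unfolding npower_def by measurable
  have eq: "npower n (density M f) = density (npower n M) ?F"
    by (rule npower_density) (auto intro: prob_space_imp_sigma_finite M N)
  have "emeasure (npower n (density M f)) E ^ 2 = (\<integral>\<^sup>+w. indicator E w * ?F w \<partial>npower n M)\<^sup>2"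
    using E by (simp add: eq emeasure_density mult.commute)
  also have "\<dots> \<le> (\<integral>\<^sup>+w. indicator E w ^ 2 \<partial>npower n M) * (\<integral>\<^sup>+w. ?F w ^ 2 \<partial>npower n M)"
    using E by (intro Cauchy_Schwarz_nn_integral) auto
  also have "(\<integral>\<^sup>+w. indicator E w ^ 2 \<partial>npower n M) = emeasure (npower n M) E"
    using E by (simp add: power2_eq_square flip: indicator_inter_arith)
  also have "(\<integral>\<^sup>+w. ?F w ^ 2 \<partial>npower n M) = (\<integral>\<^sup>+w. (\<Prod>i<n. f (w i) ^ 2) \<partial>npower n M)"
    by (simp add: prod_power_distrib)
  also have "\<dots> = (\<integral>\<^sup>+x. f x ^ 2 \<partial>M) ^ n"
    unfolding npower_def by (subst pM.product_nn_integral_prod) auto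
  also have "emeasure (npower n M) E * \<dots> \<le> emeasure (npower n M) E * ennreal (1 + c) ^ n"
    using c by (intro mult_left_mono power_mono) auto
  finally have "ennreal (measure (npower n (density M f)) E ^ 2)
      \<le> ennreal (measure (npower n M) E * (1 + c) ^ n)"
    using c(1) by (simp add: Mn.emeasure_eq_measure Nn.emeasure_eq_measure ennreal_power ennreal_mult
        del: ennreal_plus)
  then show ?thesis
    using c(1) by simp
qed

text \<open>If both masses were below \<delta>, then \<open>E\<close> would have mass below \<delta>
  under one law and above \<open>1 - \<delta>\<close> under the other. The chi-square bound excludes
  this while \<open>(1 + c) ^ n\<close> is moderate.\<close>

lemma two_point_test:
  assumes M: "prob_space M" and N: "prob_space (density M f)"
    and f: "f \<in> borel_measurable M"
    and c: "0 \<le> c" "(\<integral>\<^sup>+x. f x ^ 2 \<partial>M) \<le> ennreal (1 + c)"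
    and E: "E \<in> sets (npower n M)"
    and \<delta>: "0 \<le> \<delta>" "\<delta> \<le> 1" "\<delta> * (1 + c) ^ n \<le> (1 - \<delta>)\<^sup>2"
  shows "\<delta> \<le> measure (npower n M) E \<or>
    \<delta> \<le> measure (npower n (density M f)) (space (npower n M) - E)"
proof (rule ccontr)
  interpret Nn: prob_space "npower n (density M f)" by (rule prob_space_npower[OF N])
  have s: "sets (npower n (density M f)) = sets (npower n M)"
    unfolding npower_def by (simp cong: sets_PiM_cong)
  assume "\<not> ?thesis"
  then have 1: "measure (npower n M) E < \<delta>"
    and "measure (npower n (density M f)) (space (npower n M) - E) < \<delta>" by auto
  then have "1 - \<delta> < measure (npower n (density M f)) E"
    using Nn.prob_compl[of E] E s sets_eq_imp_space_eq[OF s] by auto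
  then have "(1 - \<delta>)\<^sup>2 < measure (npower n (density M f)) E ^ 2"
    using \<delta> by (intro power_strict_mono) auto
  also have "\<dots> \<le> measure (npower n M) E * (1 + c) ^ n"
    by (rule npower_density_chi_square) fact+
  also have "\<dots> \<le> \<delta> * (1 + c) ^ n"
    using 1 c by (intro mult_right_mono) auto
  finally show False using \<delta> by simp
qed

subsection \<open>Prediction error\<close>

abbreviation unit_lborel :: "real measure" where
  "unit_lborel \<equiv> restrict_space lborel {0..1}"

lemma prob_space_unit_lborel: "prob_space unit_lborel"
  by (rule prob_spaceI) (simp add: emeasure_restrict_space)

lemma pair_sigma_finite_ref:
  "pair_sigma_finite unit_lborel (count_space {-1, 1::int})"
proof -
  interpret R: prob_space unit_lborel by (rule prob_space_unit_lborel)
  interpret C: sigma_finite_measure "count_space {-1, 1::int}"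
    by (rule sigma_finite_measure_count_space_finite) simp
  show ?thesis ..
qed

lemma measurable_ref_section:
  assumes f: "f \<in> borel_measurable ref_measure" and y: "y \<in> {-1, 1}"
  shows "(\<lambda>x. f (x, y)) \<in> borel_measurable unit_lborel"
proof -
  have "(\<lambda>x. (x, y)) \<in> unit_lborel \<rightarrow>\<^sub>M ref_measure"
    unfolding ref_measure_def using y by (intro measurable_Pair) auto
  then show ?thesis using measurable_compose f by blast
qed

lemma integrable_ref_bounded:
  fixes f :: "real \<times> int \<Rightarrow> real"
  assumes f: "f \<in> borel_measurable ref_measure" and B: "\<And>w. w \<in> Omega \<Longrightarrow> \<bar>f w\<bar> \<le> B"
  shows "integrable ref_measure f"
proof -
  interpret R: prob_space unit_lborel by (rule prob_space_unit_lborel)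
  interpret C: finite_measure "count_space {-1, 1::int}"
    by (rule finite_measure_count_space) simp
  have "finite_measure ref_measure"
    unfolding ref_measure_def by (rule finite_measure_pair_measure) unfold_locales
  then show ?thesis
    using f B by (intro finite_measure.integrable_const_bound[where B = B])
      (auto intro!: AE_I2 simp: space_ref_measure)
qed

lemma integral_ref:
  fixes f :: "real \<times> int \<Rightarrow> real"
  assumes f: "integrable ref_measure f"
  shows "(\<integral>w. f w \<partial>ref_measure) = (\<integral>x. f (x, 1) + f (x, -1) \<partial>unit_lborel)"
proof -
  interpret RC: pair_sigma_finite unit_lborel "count_space {-1, 1::int}"
    by (rule pair_sigma_finite_ref)
  have "(\<integral>w. f w \<partial>ref_measure) = (\<integral>x. (\<integral>y. f (x, y) \<partial>count_space {-1, 1}) \<partial>unit_lborel)"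
    using RC.integral_fst'[of f] f by (simp add: ref_measure_def)
  then show ?thesis
    by (simp add: lebesgue_integral_count_space_finite add.commute)
qed

lemma is_C1_density_bounded:
  assumes "is_C1_density P p"
  obtains B where "\<And>w. w \<in> Omega \<Longrightarrow> \<bar>p w\<bar> \<le> B"
proof -
  have "compact Omega" unfolding Omega_def by (intro compact_Times) auto
  then have "bounded (p ` Omega)"
    by (intro compact_imp_bounded compact_continuous_image is_C1_density_continuous[OF assms])
  then show ?thesis using that by (auto simp: bounded_iff)
qed

text \<open>The classifier errs on label 1 left of the threshold and on label -1 from the threshold
  on. Estimators may leave the unit interval, so \<alpha> is an arbitrary real.\<close>

lemma pred_error_eq:
  assumes p: "is_C1_density P p"
  shows "pred_error P \<alpha> =
    (\<integral>x. p (x, 1) * indicator {..<\<alpha>} x + p (x, -1) * indicator {\<alpha>..} x \<partial>unit_lborel)"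
proof -
  obtain B where B: "\<And>w. w \<in> Omega \<Longrightarrow> \<bar>p w\<bar> \<le> B"
    using is_C1_density_bounded[OF p] by blast
  have P: "P = density ref_measure (\<lambda>w. ennreal (p w))" and p0: "\<And>w. w \<in> Omega \<Longrightarrow> 0 \<le> p w"
    using p by (auto simp: is_C1_density_def)
  note pm[measurable] = is_C1_density_measurable[OF p]
  define A where "A = {w \<in> Omega. classifier \<alpha> (fst w) \<noteq> snd w}"
  have "A = ({0..1} \<inter> {..<\<alpha>}) \<times> {1} \<union> ({0..1} \<inter> {\<alpha>..}) \<times> {-1}"
    by (auto simp: A_def Omega_def classifier_def)
  also have "\<dots> \<in> sets ref_measure"
    unfolding ref_measure_def
    by (intro sets.Un pair_measureI) (auto simp: sets_restrict_space)
  finally have A[measurable]: "A \<in> sets ref_measure" .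
  have "A \<inter> Omega = A" by (auto simp: A_def)
  then have "pred_error P \<alpha> = (\<integral>w. indicator A w \<partial>P)"
    using A by (simp add: pred_error_def P space_ref_measure flip: A_def)
  also have "\<dots> = (\<integral>w. p w * indicator A w \<partial>ref_measure)"
    unfolding P by (subst integral_density) (auto simp: space_ref_measure p0)
  also have "\<dots> = (\<integral>x. p (x, 1) * indicator A (x, 1) + p (x, -1) * indicator A (x, -1) \<partial>unit_lborel)"
  proof (rule integral_ref, rule integrable_ref_bounded)
    show "\<bar>p w * indicator A w\<bar> \<le> B" if "w \<in> Omega" for w
      using B[OF that] by (auto simp: indicator_def)
  qed measurable
  also have "\<dots> = (\<integral>x. p (x, 1) * indicator {..<\<alpha>} x + p (x, -1) * indicator {\<alpha>..} x \<partial>unit_lborel)"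
    by (intro Bochner_Integration.integral_cong)
      (auto simp: A_def Omega_def classifier_def indicator_def space_restrict_space)
  finally show ?thesis .
qed

text \<open>An integral of a jointly measurable function is measurable in its parameter. Composed
  with an estimator, this makes the excess-error events measurable.\<close>

lemma borel_measurable_pred_error:
  assumes p: "is_C1_density P p"
  shows "pred_error P \<in> borel_measurable borel"
proof -
  interpret R: prob_space unit_lborel by (rule prob_space_unit_lborel)
  note pm = is_C1_density_measurable[OF p]
  note pm1[measurable] = measurable_ref_section[OF pm, of 1, simplified]
    measurable_ref_section[OF pm, of "-1", simplified]
  have [measurable]: "(\<lambda>x. x) \<in> borel_measurable unit_lborel"
    by (rule measurable_restrict_space1) simp
  \<comment> \<open>Conditionals replace the indicators of sets depending on \<alpha>, so that joint
    measurability in \<alpha> and \<open>x\<close> becomes visible.\<close>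
  have "pred_error P = (\<lambda>\<alpha>. \<integral>x. p (x, 1) * (if x < \<alpha> then 1 else 0)
      + p (x, -1) * (if x < \<alpha> then 0 else 1) \<partial>unit_lborel)"
    by (rule ext, subst pred_error_eq[OF p])
      (auto intro!: Bochner_Integration.integral_cong simp: indicator_def)
  also have "\<dots> \<in> borel_measurable borel"
    by measurable
  finally show ?thesis .
qed

text \<open>Moving the threshold from \<beta> up to \<alpha> changes the prediction only on
  \<open>[\<beta>, \<alpha>)\<close>, where the cost \<open>p (x, -1)\<close> is traded for
  \<open>p (x, 1)\<close>.\<close>

lemma pred_error_diff:
  assumes p: "is_C1_density P p" and le: "\<beta> \<le> \<alpha>"
  shows "pred_error P \<alpha> - pred_error P \<beta> =
    (\<integral>x. (p (x, 1) - p (x, -1)) * indicator {\<beta>..<\<alpha>} x \<partial>unit_lborel)"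
proof -
  interpret R: prob_space unit_lborel by (rule prob_space_unit_lborel)
  obtain B where B: "\<And>w. w \<in> Omega \<Longrightarrow> \<bar>p w\<bar> \<le> B"
    using is_C1_density_bounded[OF p] by blast
  note pm = is_C1_density_measurable[OF p]
  note pm1 = measurable_ref_section[OF pm, of 1, simplified]
    measurable_ref_section[OF pm, of "-1", simplified]
  have int: "integrable unit_lborel
      (\<lambda>x. p (x, 1) * indicator {..<\<alpha>} x + p (x, -1) * indicator {\<alpha>..} x)" for \<alpha>
  proof (rule R.integrable_const_bound[where B = B])
    show "(\<lambda>x. p (x, 1) * indicator {..<\<alpha>} x + p (x, -1) * indicator {\<alpha>..} x)
      \<in> borel_measurable unit_lborel"
      by (intro borel_measurable_add borel_measurable_times pm1 borel_measurable_indicator'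
          measurable_restrict_space1) auto
    have "\<bar>p (x, 1)\<bar> \<le> B" "\<bar>p (x, -1)\<bar> \<le> B" if "x \<in> {0..1}" for x
      using that by (auto intro!: B simp: Omega_def)
    then show "AE x in unit_lborel.
        norm (p (x, 1) * indicator {..<\<alpha>} x + p (x, -1) * indicator {\<alpha>..} x) \<le> B"
      by (auto intro!: AE_I2 simp: space_restrict_space indicator_def)
  qed
  show ?thesis
    using le unfolding pred_error_eq[OF p] Bochner_Integration.integral_diff[OF int int, symmetric]
    by (auto intro!: Bochner_Integration.integral_cong simp: indicator_def)
qed

text \<open>The sign \<open>\<sigma>\<close> serves both for \<open>\<beta>\<close> the optimal threshold (\<open>\<sigma> = 1\<close>) and for \<open>\<alpha>\<close> the
  optimal threshold (\<open>\<sigma> = -1\<close>).\<close>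

lemma pred_error_gap:
  assumes p: "is_C1_density P p" and le: "\<beta> \<le> \<alpha>"
    and nn: "\<And>x. \<lbrakk>x \<in> {0..1}; \<beta> \<le> x; x < \<alpha>\<rbrakk> \<Longrightarrow> 0 \<le> \<sigma> * (p (x, 1) - p (x, -1))"
    and uv: "0 \<le> u" "u \<le> v" "v \<le> 1" "\<beta> \<le> u" "v \<le> \<alpha>"
    and s: "\<And>x. \<lbrakk>u \<le> x; x < v\<rbrakk> \<Longrightarrow> s \<le> \<sigma> * (p (x, 1) - p (x, -1))"
  shows "s * (v - u) \<le> \<sigma> * (pred_error P \<alpha> - pred_error P \<beta>)"
proof -
  interpret R: prob_space unit_lborel by (rule prob_space_unit_lborel)
  obtain B where B: "\<And>w. w \<in> Omega \<Longrightarrow> \<bar>p w\<bar> \<le> B"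
    using is_C1_density_bounded[OF p] by blast
  note pm = is_C1_density_measurable[OF p]
  note pm1 = measurable_ref_section[OF pm, of 1, simplified]
    measurable_ref_section[OF pm, of "-1", simplified]
  have uv_sets: "{u..<v} \<in> sets unit_lborel"
    using uv by (auto simp: sets_restrict_space intro!: image_eqI[of _ _ "{u..<v}"])
  have "s * (v - u) = (\<integral>x. s * indicator {u..<v} x \<partial>unit_lborel)"
  proof -
    have sub: "{u..<v} \<subseteq> {0..1}" using uv by auto
    then have "measure unit_lborel {u..<v} = v - u" using uv by (subst measure_restrict_space) auto
    then show ?thesis using uv_sets by (simp add: Int_absorb2[OF sub])
  qed
  also have "\<dots> \<le> (\<integral>x. \<sigma> * ((p (x, 1) - p (x, -1)) * indicator {\<beta>..<\<alpha>} x) \<partial>unit_lborel)"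
  proof (rule integral_mono)
    show "integrable unit_lborel (\<lambda>x. s * indicator {u..<v} x)"
      using uv_sets by (simp add: R.emeasure_eq_measure)
    have "integrable unit_lborel (\<lambda>x. (p (x, 1) - p (x, -1)) * indicator {\<beta>..<\<alpha>} x)"
    proof (rule R.integrable_const_bound[where B = "2 * B"])
      show "(\<lambda>x. (p (x, 1) - p (x, -1)) * indicator {\<beta>..<\<alpha>} x) \<in> borel_measurable unit_lborel"
        by (intro borel_measurable_diff borel_measurable_times pm1 borel_measurable_indicator'
          measurable_restrict_space1) auto
      have "\<bar>p (x, 1) - p (x, -1)\<bar> \<le> 2 * B" if "x \<in> {0..1}" for x
        using that B[of "(x, 1)"] B[of "(x, -1)"] by (auto simp: Omega_def)
      then show "AE x in unit_lborel. norm ((p (x, 1) - p (x, -1)) * indicator {\<beta>..<\<alpha>} x) \<le> 2 * B"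
        by (fastforce intro!: AE_I2 simp: space_restrict_space indicator_def)
    qed
    then show "integrable unit_lborel (\<lambda>x. \<sigma> * ((p (x, 1) - p (x, -1)) * indicator {\<beta>..<\<alpha>} x))"
      by (rule integrable_mult_right)
    fix x assume "x \<in> space unit_lborel"
    \<comment> \<open>On \<open>[u, v)\<close> the bound \<open>s\<close> applies; elsewhere the
      left side is 0 and \<open>nn\<close> keeps the right side nonnegative.\<close>
    then show "s * indicator {u..<v} x \<le> \<sigma> * ((p (x, 1) - p (x, -1)) * indicator {\<beta>..<\<alpha>} x)"
      using nn[of x] s[of x] uv by (auto simp: indicator_def space_restrict_space)
  qed
  also have "\<dots> = \<sigma> * (pred_error P \<alpha> - pred_error P \<beta>)"
    by (simp add: pred_error_diff[OF p le])
  finally show ?thesis .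
qed

subsection \<open>Crossing points\<close>

lemma has_real_derivative_dens:
  assumes P: "P \<in> P_tilde" and x: "x \<in> {0..1}" and y: "y \<in> {-1, 1}"
  shows "((\<lambda>x. dens P (x, y)) has_real_derivative dens_deriv P (x, y)) (at x within {0..1})"
proof -
  have "C1_unit (\<lambda>x. dens P (x, y))"
    using is_C1_density_dens[OF P] y by (auto simp: is_C1_density_def)
  then have "(\<lambda>x. dens P (x, y)) differentiable (at x within {0..1})"
    using x unfolding C1_unit_def real_differentiable_def by blast
  then show ?thesis
    unfolding dens_deriv_def has_real_derivative_iff_has_vector_derivative
    by (simp add: vector_derivative_works)
qed

lemma dens_eqI:
  assumes "P \<in> P_tilde" "is_C1_density P q" "x \<in> {0..1}" "y \<in> {-1, 1}"
  shows "dens P (x, y) = q (x, y)"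
  using is_C1_density_unique[OF is_C1_density_dens[OF assms(1)] assms(2)] assms(3,4)
  by (auto simp: Omega_def)

text \<open>\<open>dens P\<close> and \<open>q\<close> need only agree on \<open>Omega\<close>; the
  derivative within the unit interval sees no other values.\<close>

lemma dens_deriv_eqI:
  assumes P: "P \<in> P_tilde" "is_C1_density P q" and x: "x \<in> {0..1}" and y: "y \<in> {-1, 1}"
    and d: "((\<lambda>x. q (x, y)) has_real_derivative d) (at x within {0..1})"
  shows "dens_deriv P (x, y) = d"
proof -
  have "((\<lambda>x. dens P (x, y)) has_real_derivative d) (at x within {0..1})"
    by (rule has_field_derivative_transform_within[OF d zero_less_one x])
      (use dens_eqI[OF P _ y] in auto)
  then show ?thesis
    unfolding dens_deriv_def using x
    by (auto simp: has_real_derivative_iff_has_vector_derivative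
        intro!: vector_derivative_within_closed_interval)
qed

text \<open>Its sign tells which label is more likely at \<open>x\<close>, and its zeros in the unit
  interval are the crossing points.\<close>

definition dens_diff :: "(real \<times> int) measure \<Rightarrow> real \<Rightarrow> real" where
  "dens_diff P x = dens P (x, 1) - dens P (x, -1)"

definition dens_diff_deriv :: "(real \<times> int) measure \<Rightarrow> real \<Rightarrow> real" where
  "dens_diff_deriv P x = dens_deriv P (x, 1) - dens_deriv P (x, -1)"

lemma has_real_derivative_dens_diff:
  assumes "P \<in> P_tilde" "x \<in> {0..1}"
  shows "(dens_diff P has_real_derivative dens_diff_deriv P x) (at x within {0..1})"
  unfolding dens_diff_def dens_diff_deriv_def
  by (rule DERIV_diff; rule has_real_derivative_dens[OF assms]; simp)

lemma continuous_on_dens_diff: "continuous_on {0..1} (dens_diff P)"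
  unfolding dens_diff_def by (intro continuous_intros dens_deriv_continuous) auto

lemma continuous_on_dens_diff_deriv: "continuous_on {0..1} (dens_diff_deriv P)"
  unfolding dens_diff_deriv_def by (intro continuous_intros dens_deriv_continuous) auto

lemma crossing_iff: "crossing P a \<longleftrightarrow> a \<in> {0..1} \<and> dens_diff P a = 0"
  by (auto simp: crossing_def dens_diff_def)

lemma at_within_unit: "x \<in> {0<..<1} \<Longrightarrow> at x within {0..1} = at (x::real)"
  by (rule at_within_interior) (simp add: interior_atLeastAtMost_real)

lemma P_classD:
  assumes "P \<in> P_class"
  shows "P \<in> P_tilde" "cross_pt P \<in> {0<..<1}" "dens_diff P (cross_pt P) = 0"
    "0 < dens_diff_deriv P (cross_pt P)"
    "\<And>x. \<lbrakk>x \<in> {0..1}; dens_diff P x = 0\<rbrakk> \<Longrightarrow> x = cross_pt P"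
proof -
  have ex: "\<exists>!a. crossing P a" using assms by (simp add: P_class_def)
  from theI'[OF ex] have c: "crossing P (cross_pt P)" by (simp add: cross_pt_def)
  show "P \<in> P_tilde" "cross_pt P \<in> {0<..<1}" "0 < dens_diff_deriv P (cross_pt P)"
    using assms by (auto simp: P_class_def dens_diff_deriv_def)
  show "dens_diff P (cross_pt P) = 0" using c by (simp add: crossing_iff)
  show "x = cross_pt P" if "x \<in> {0..1}" "dens_diff P x = 0" for x
    using ex c that crossing_iff[of P x] by blast
qed

text \<open>The positive slope fixes the sign next to the crossing point; a wrong sign further away
  would force a second zero by the intermediate value theorem.\<close>

lemma P_class_sign:
  assumes P: "P \<in> P_class" and x: "x \<in> {0..1}"
  shows "cross_pt P < x \<Longrightarrow> 0 < dens_diff P x" "x < cross_pt P \<Longrightarrow> dens_diff P x < 0"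
proof -
  let ?a = "cross_pt P"
  note D = P_classD[OF P]
  have der: "(dens_diff P has_real_derivative dens_diff_deriv P ?a) (at ?a)"
    using has_real_derivative_dens_diff[OF D(1), of ?a] D(2) at_within_unit[OF D(2)] by simp
  show "0 < dens_diff P x" if ax: "?a < x"
  proof (rule ccontr)
    assume neg: "\<not> 0 < dens_diff P x"
    obtain d where d: "0 < d" "\<And>h. \<lbrakk>0 < h; h < d\<rbrakk> \<Longrightarrow> dens_diff P ?a < dens_diff P (?a + h)"
      using DERIV_pos_inc_right[OF der D(4)] by auto
    \<comment> \<open>A step small enough for the slope at the crossing point to decide the sign,
      and not reaching beyond \<open>x\<close>.\<close>
    define h where "h = min (d/2) (x - ?a)"
    have h: "0 < h" "h < d" "?a + h \<le> x" using d(1) ax by (auto simp: h_def)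
    have "continuous_on {?a + h..x} (dens_diff P)"
      using h D(2) x by (intro continuous_on_subset[OF continuous_on_dens_diff]) auto
    from IVT2'[of "dens_diff P" x 0 "?a + h", OF _ _ h(3) this]
    obtain z where "?a + h \<le> z" "z \<le> x" "dens_diff P z = 0"
      using neg d(2)[OF h(1,2)] D(3) by force
    then show False using D(5)[of z] h x D(2) by auto
  qed
  show "dens_diff P x < 0" if ax: "x < ?a"
  proof (rule ccontr)
    assume neg: "\<not> dens_diff P x < 0"
    obtain d where d: "0 < d" "\<And>h. \<lbrakk>0 < h; h < d\<rbrakk> \<Longrightarrow> dens_diff P (?a - h) < dens_diff P ?a"
      using DERIV_pos_inc_left[OF der D(4)] by auto
    define h where "h = min (d/2) (?a - x)"
    have h: "0 < h" "h < d" "x \<le> ?a - h" using d(1) ax by (auto simp: h_def)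
    have "continuous_on {x..?a - h} (dens_diff P)"
      using h D(2) x by (intro continuous_on_subset[OF continuous_on_dens_diff]) auto
    from IVT2'[of "dens_diff P" "?a - h" 0 x, OF _ _ h(3) this]
    obtain z where "x \<le> z" "z \<le> ?a - h" "dens_diff P z = 0"
      using neg d(2)[OF h(1,2)] D(3) by force
    then show False using D(5)[of z] h x D(2) by auto
  qed
qed

text \<open>If both densities vanished at the interior point \<open>cross_pt P\<close>, they would have minima
  there, and the slopes could not differ.\<close>

lemma dens_cross_pt_pos:
  assumes P: "P \<in> P_class" and y: "y \<in> {-1, 1}"
  shows "0 < dens P (cross_pt P, y)"
proof (rule ccontr)
  let ?a = "cross_pt P"
  note D = P_classD[OF P]
  assume "\<not> 0 < dens P (?a, y)"
  moreover have nn: "0 \<le> dens P (x, z)" if "x \<in> {0..1}" "z \<in> {-1, 1}" for x z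
    using is_C1_density_dens[OF D(1)] that by (auto simp: is_C1_density_def Omega_def)
  ultimately have "dens P (?a, y) = 0"
    using nn[OF _ y, of ?a] D(2) by simp
  \<comment> \<open>The two densities agree at the crossing point, so they vanish there
    together.\<close>
  then have 0: "dens P (?a, z) = 0" if "z \<in> {-1, 1}" for z
    using that y D(3) by (auto simp: dens_diff_def)
  \<comment> \<open>The radius \<open>min ?a (1 - ?a)\<close> keeps all compared points in the unit
    interval, where the density is nonnegative.\<close>
  have "dens_deriv P (?a, z) = 0" if z: "z \<in> {-1, 1}" for z
  proof (rule DERIV_local_min[where d = "min ?a (1 - ?a)"])
    show "((\<lambda>x. dens P (x, z)) has_real_derivative dens_deriv P (?a, z)) (at ?a)"
      using has_real_derivative_dens[OF D(1) _ z, of ?a] D(2) at_within_unit[OF D(2)] by simp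
    show "\<forall>x. \<bar>?a - x\<bar> < min ?a (1 - ?a) \<longrightarrow> dens P (?a, z) \<le> dens P (x, z)"
      using 0[OF z] z by (auto intro!: nn)
  qed (use D(2) in auto)
  from this[of 1] this[of "-1"] D(4) show False by (simp add: dens_diff_deriv_def)
qed

section \<open>A bump function of class C^1\<close>

definition bump :: "real \<Rightarrow> real" where
  "bump u = (max 0 (1 - u\<^sup>2))\<^sup>2"

definition bump_deriv :: "real \<Rightarrow> real" where
  "bump_deriv u = - 4 * u * max 0 (1 - u\<^sup>2)"

lemma bump_bounds: "0 \<le> bump u" "bump u \<le> 1"
  by (auto simp: bump_def max_def abs_square_le_1 power_le_one)

lemma bump_outside: "1 \<le> \<bar>u\<bar> \<Longrightarrow> bump u = 0"
proof -
  assume "1 \<le> \<bar>u\<bar>"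
  then have "1 \<le> u\<^sup>2" using power_mono[of 1 "\<bar>u\<bar>" 2] by simp
  then show ?thesis by (simp add: bump_def)
qed

lemma bump_deriv_bound: "\<bar>bump_deriv u\<bar> \<le> 4"
proof (cases "\<bar>u\<bar> \<le> 1")
  case True
  then have "\<bar>u\<bar> * max 0 (1 - u\<^sup>2) \<le> 1 * 1"
    by (intro mult_mono) auto
  then show ?thesis by (simp add: bump_deriv_def abs_mult)
next
  case False
  then have "1 \<le> u\<^sup>2" using power_mono[of 1 "\<bar>u\<bar>" 2] by simp
  then show ?thesis by (simp add: bump_deriv_def)
qed

text \<open>Squaring removes the kink of \<open>max 0 y\<close>: at 0 the difference quotient is at
  most \<open>\<bar>h\<bar>\<close>. Hence \<open>bump\<close> is differentiable at the edge of its
  support.\<close>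

lemma has_real_derivative_max_0_square:
  "((\<lambda>y::real. (max 0 y)\<^sup>2) has_real_derivative 2 * max 0 y) (at y)"
proof (cases y "0::real" rule: linorder_cases)
  case less
  have "((\<lambda>y::real. 0) has_real_derivative 2 * max 0 y) (at y)"
    using less by simp
  then show ?thesis
    by (rule DERIV_cong_ev[THEN iffD1, rotated -1])
      (use less eventually_nhds_in_open[of "{..<0}" y] in \<open>auto elim!: eventually_mono\<close>)
next
  case greater
  have "((\<lambda>y::real. y\<^sup>2) has_real_derivative 2 * max 0 y) (at y)"
    using greater by (auto intro!: derivative_eq_intros)
  then show ?thesis
    by (rule DERIV_cong_ev[THEN iffD1, rotated -1])
      (use greater eventually_nhds_in_open[of "{0<..}" y] in \<open>auto elim!: eventually_mono\<close>)
next
  case equal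
  have "(\<lambda>h::real. (max 0 h)\<^sup>2 / h) \<midarrow>0\<rightarrow> 0"
  proof (rule Lim_null_comparison)
    show "\<forall>\<^sub>F h::real in at 0. norm ((max 0 h)\<^sup>2 / h) \<le> \<bar>h\<bar>"
      by (rule always_eventually) (auto simp: max_def power2_eq_square)
    show "(\<lambda>h::real. \<bar>h\<bar>) \<midarrow>0\<rightarrow> 0" by (rule tendsto_rabs_zero) simp
  qed
  then show ?thesis using equal by (simp add: DERIV_def)
qed

lemma has_real_derivative_bump: "(bump has_real_derivative bump_deriv u) (at u)"
proof -
  have "((\<lambda>u. 1 - u\<^sup>2) has_real_derivative - 2 * u) (at u)"
    by (auto intro!: derivative_eq_intros)
  from DERIV_chain2[OF has_real_derivative_max_0_square this]
  show ?thesis by (simp add: bump_def[abs_def] bump_deriv_def mult_ac)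
qed

lemma continuous_on_bump_deriv: "continuous_on A bump_deriv"
  unfolding bump_deriv_def by (intro continuous_intros)

subsection \<open>The perturbation\<close>

lemma dens_diff_increment:
  assumes P: "P \<in> P_tilde" and xz: "x \<le> z" "{x..z} \<subseteq> {0<..<1}"
    and lu: "\<And>s. s \<in> {x..z} \<Longrightarrow> l \<le> dens_diff_deriv P s" "\<And>s. s \<in> {x..z} \<Longrightarrow> dens_diff_deriv P s \<le> u"
  shows "l * (z - x) \<le> dens_diff P z - dens_diff P x" "dens_diff P z - dens_diff P x \<le> u * (z - x)"
proof -
  have "l * (z - x) \<le> dens_diff P z - dens_diff P x \<and> dens_diff P z - dens_diff P x \<le> u * (z - x)"
  proof (cases "x = z")
    case False
    then have "x < z" using xz by simp
    moreover have "(dens_diff P has_real_derivative dens_diff_deriv P s) (at s)" if "x \<le> s" "s \<le> z" for s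
    proof -
      have "s \<in> {0<..<1}" using that xz by auto
      then show ?thesis
        using has_real_derivative_dens_diff[OF P, of s] at_within_unit[of s] by simp
    qed
    ultimately obtain s where s: "x < s" "s < z"
      and eq: "dens_diff P z - dens_diff P x = (z - x) * dens_diff_deriv P s"
      using MVT2[of x z "dens_diff P" "dens_diff_deriv P"] by blast
    then show ?thesis
      unfolding eq using xz lu[of s] by (auto simp: mult.commute[of "z - x"] intro!: mult_right_mono)
  qed simp
  then show "l * (z - x) \<le> dens_diff P z - dens_diff P x"
    "dens_diff P z - dens_diff P x \<le> u * (z - x)" by auto
qed

text \<open>On the window of radius \<eta> the densities are at least \<open>m\<close> and the slope
  difference is within a factor 2 of \<open>D\<close>. The bounds on \<open>t\<close> keep the bump
  inside the window and below the densities; \<open>\<epsilon> \<le> D / 32\<close> keeps the slope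
  difference positive after the perturbation.\<close>

locale perturbed_class =
  fixes P :: "(real \<times> int) measure" and \<eta> m D \<epsilon> t :: real
  assumes P: "P \<in> P_class"
    and window: "{cross_pt P - \<eta>..cross_pt P + \<eta>} \<subseteq> {0<..<1}"
    and m: "0 < m" "\<And>x y. \<lbrakk>\<bar>x - cross_pt P\<bar> \<le> \<eta>; y \<in> {-1, 1}\<rbrakk> \<Longrightarrow> m \<le> dens P (x, y)"
    and D: "0 < D" "\<And>x. \<bar>x - cross_pt P\<bar> \<le> \<eta> \<Longrightarrow> D / 2 \<le> dens_diff_deriv P x"
      "\<And>x. \<bar>x - cross_pt P\<bar> \<le> \<eta> \<Longrightarrow> dens_diff_deriv P x \<le> 2 * D"
    and eps: "0 < \<epsilon>" "\<epsilon> \<le> D / 32"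
    and t: "0 < t" "t \<le> \<eta>" "\<epsilon> * t \<le> m"
begin

abbreviation a :: real where "a \<equiv> cross_pt P"

definition g :: "real \<Rightarrow> real" where
  "g x = \<epsilon> * t * bump ((x - a) / t)"

definition g' :: "real \<Rightarrow> real" where
  "g' x = \<epsilon> * bump_deriv ((x - a) / t)"

text \<open>The likelihood ratio of \<open>Q\<close> against \<open>P\<close>. The factor
  \<open>of_int y\<close> raises the density of label 1 and lowers that of label -1 by the same
  amount.\<close>

definition ratio :: "real \<times> int \<Rightarrow> real" where
  "ratio = (\<lambda>(x, y). 1 + of_int y * g x / dens P (x, y))"

text \<open>Given as a density over \<open>P\<close>, the form in which the two-point bound takes
  the second law; \<open>q\<close> is the density with respect to
  \<open>ref_measure\<close>.\<close>

definition Q :: "(real \<times> int) measure" where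
  "Q = density P (\<lambda>w. ennreal (ratio w))"

definition q :: "real \<times> int \<Rightarrow> real" where
  "q = (\<lambda>(x, y). dens P (x, y) + of_int y * g x)"

lemmas P_facts = P_classD[OF P]
lemmas dens_P = is_C1_density_dens[OF P_facts(1)]

lemma window_unit: "\<bar>x - a\<bar> \<le> \<eta> \<Longrightarrow> x \<in> {0<..<1}"
  by (rule subsetD[OF window]) (auto simp: abs_le_iff)

lemma g_bounds: "0 \<le> g x" "g x \<le> \<epsilon> * t"
  using bump_bounds[of "(x - a) / t"] eps t by (auto simp: g_def mult_left_le)

lemma g_outside: "t \<le> \<bar>x - a\<bar> \<Longrightarrow> g x = 0"
  using bump_outside[of "(x - a) / t"] t by (simp add: g_def)

lemma g_center: "g a = \<epsilon> * t"
  by (simp add: g_def bump_def)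

lemma g'_bound: "\<bar>g' x\<bar> \<le> 4 * \<epsilon>"
  using bump_deriv_bound[of "(x - a) / t"] eps by (simp add: g'_def abs_mult)

lemma has_real_derivative_g: "(g has_real_derivative g' x) (at x within S)"
proof -
  have "((\<lambda>x. (x - a) / t) has_real_derivative 1 / t) (at x)"
    using t by (auto intro!: derivative_eq_intros)
  from DERIV_cmult[OF DERIV_chain2[OF has_real_derivative_bump this], of "\<epsilon> * t"]
  have "(g has_real_derivative g' x) (at x)"
    using t by (simp add: g_def[abs_def] g'_def)
  then show ?thesis by (rule has_field_derivative_at_within)
qed

lemma continuous_on_g': "continuous_on S g'"
  unfolding g'_def
  by (intro continuous_intros continuous_on_compose2[OF continuous_on_bump_deriv[of UNIV]])
    (use t in auto)

lemma continuous_on_g: "continuous_on S g"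
  by (rule DERIV_continuous_on[OF has_real_derivative_g])

lemma dens_P_nonneg: "w \<in> Omega \<Longrightarrow> 0 \<le> dens P w"
  using dens_P by (auto simp: is_C1_density_def)

text \<open>On its support the bump has height at most \<open>\<epsilon> * t \<le> m\<close>. This
  makes \<open>q\<close> nonnegative.\<close>

lemma g_le_dens:
  assumes "(x, y) \<in> Omega"
  shows "g x \<le> dens P (x, y)"
proof (cases "\<bar>x - a\<bar> \<le> t")
  case True
  then have "m \<le> dens P (x, y)" using assms t by (intro m) (auto simp: Omega_def)
  then show ?thesis using g_bounds[of x] t by linarith
qed (use assms g_outside dens_P_nonneg in auto)

text \<open>Pointwise bound for the chi-square integrand: the squared height over the least density,
  on a support of length \<open>2 * t\<close>.\<close>

lemma g_square_div_dens_le: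
  assumes "(x, y) \<in> Omega"
  shows "(g x)\<^sup>2 / dens P (x, y) \<le> (\<epsilon> * t)\<^sup>2 / m * indicator {a - t..a + t} x"
proof (cases "\<bar>x - a\<bar> \<le> t")
  case True
  then have "m \<le> dens P (x, y)" using assms t by (intro m) (auto simp: Omega_def)
  then have "(g x)\<^sup>2 / dens P (x, y) \<le> (\<epsilon> * t)\<^sup>2 / m"
    using g_bounds[of x] m(1) by (intro frac_le power_mono) auto
  then show ?thesis using True by (simp add: indicator_def abs_le_iff)
qed (use g_outside m in \<open>auto simp: indicator_def\<close>)

text \<open>Where \<open>dens P\<close> vanishes, so does \<open>g\<close>, and the junk value of the division is harmless.\<close>

lemma dens_ratio:
  assumes "w \<in> Omega"
  shows "dens P w * ratio w = q w"
    "dens P w * (ratio w)\<^sup>2 = dens P w + 2 * (of_int (snd w) * g (fst w)) + (g (fst w))\<^sup>2 / dens P w"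
proof -
  obtain x y where w: "w = (x, y)" "y = -1 \<or> y = 1" using assms by (auto simp: Omega_def)
  have "g x = 0" if "dens P (x, y) = 0"
    using g_le_dens[of x y] g_bounds[of x] that assms w by simp
  then show "dens P w * ratio w = q w"
    "dens P w * (ratio w)\<^sup>2 = dens P w + 2 * (of_int (snd w) * g (fst w)) + (g (fst w))\<^sup>2 / dens P w"
    using w(2) by (auto simp: w(1) ratio_def q_def field_simps power2_eq_square)
qed

lemma q_nonneg: "w \<in> Omega \<Longrightarrow> 0 \<le> q w"
  using g_le_dens g_bounds dens_P_nonneg by (fastforce simp: q_def Omega_def)

lemma ratio_nonneg:
  assumes "w \<in> Omega"
  shows "0 \<le> ratio w"
proof -
  obtain x y where w: "w = (x, y)" "y = -1 \<or> y = 1" using assms by (auto simp: Omega_def)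
  have "g x / dens P (x, y) \<le> 1" "0 \<le> g x / dens P (x, y)"
    using g_le_dens[of x y] g_bounds[of x] dens_P_nonneg[OF assms] assms w
    by (auto simp: divide_le_eq)
  then show ?thesis using w by (auto simp: ratio_def)
qed

lemma measurable_g_fst [measurable]: "(\<lambda>w. g (fst w)) \<in> borel_measurable ref_measure"
proof -
  have "fst \<in> ref_measure \<rightarrow>\<^sub>M unit_lborel"
    unfolding ref_measure_def by simp
  moreover have "g \<in> borel_measurable unit_lborel"
    using borel_measurable_continuous_onI[OF continuous_on_g] by (intro measurable_restrict_space1) simp
  ultimately show ?thesis by (rule measurable_compose)
qed

lemma measurable_snd_ref [measurable]: "snd \<in> ref_measure \<rightarrow>\<^sub>M count_space UNIV"
  unfolding ref_measure_def by (rule measurable_compose[OF measurable_snd]) simp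

lemma measurable_dens_P [measurable]: "dens P \<in> borel_measurable ref_measure"
  by (rule is_C1_density_measurable[OF dens_P])

lemma measurable_ratio [measurable]: "ratio \<in> borel_measurable ref_measure"
  unfolding ratio_def case_prod_beta prod.collapse by measurable

lemma measurable_q: "q \<in> borel_measurable ref_measure"
  unfolding q_def case_prod_beta prod.collapse by measurable

lemma P_eq: "P = density ref_measure (\<lambda>w. ennreal (dens P w))"
  using dens_P by (simp only: is_C1_density_def)

lemma Q_eq: "Q = density ref_measure (\<lambda>w. ennreal (q w))"
proof -
  have "Q = density (density ref_measure (\<lambda>w. ennreal (dens P w))) (\<lambda>w. ennreal (ratio w))"
    using P_eq by (simp add: Q_def)
  also have "\<dots> = density ref_measure (\<lambda>w. ennreal (dens P w) * ennreal (ratio w))"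
    by (rule density_density_eq) measurable
  also have "\<dots> = density ref_measure (\<lambda>w. ennreal (q w))"
    using measurable_q
    by (intro density_cong) (auto intro!: AE_I2 simp: space_ref_measure dens_P_nonneg ratio_nonneg
        dens_ratio simp flip: ennreal_mult)
  finally show ?thesis .
qed

lemma has_real_derivative_q:
  assumes "x \<in> {0..1}" "y \<in> {-1, 1}"
  shows "((\<lambda>x. q (x, y)) has_real_derivative dens_deriv P (x, y) + of_int y * g' x) (at x within {0..1})"
  unfolding q_def prod.case
  by (intro DERIV_add DERIV_cmult has_real_derivative_dens has_real_derivative_g P_facts(1) assms)

lemma is_C1_density_q: "is_C1_density Q q"
  unfolding is_C1_density_def
proof (intro conjI ballI)
  show "C1_unit (\<lambda>x. q (x, y))" if "y \<in> {-1, 1}" for y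
    unfolding C1_unit_def
    by (rule exI[of _ "\<lambda>x. dens_deriv P (x, y) + of_int y * g' x"])
      (intro conjI ballI has_real_derivative_q continuous_intros dens_deriv_continuous continuous_on_g' that)
qed (auto simp: q_nonneg Q_eq)

section \<open>Mass, distance and class membership of the perturbed law\<close>

lemma integrable_dens_P: "integrable ref_measure (dens P)"
proof -
  obtain B where "\<And>w. w \<in> Omega \<Longrightarrow> \<bar>dens P w\<bar> \<le> B"
    using is_C1_density_bounded[OF dens_P] by blast
  then show ?thesis by (rule integrable_ref_bounded[OF measurable_dens_P])
qed

lemma integrable_signed_g: "integrable ref_measure (\<lambda>w. of_int (snd w) * g (fst w))"
  by (rule integrable_ref_bounded[where B = "\<epsilon> * t"])
    (use g_bounds in \<open>auto simp: Omega_def\<close>)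

text \<open>The two labels contribute with opposite signs, so the perturbation adds no mass.\<close>

lemma integral_signed_g: "(\<integral>w. of_int (snd w) * g (fst w) \<partial>ref_measure) = 0"
  by (simp add: integral_ref[OF integrable_signed_g])

lemma prob_space_P: "prob_space P"
  using P_facts(1) by (simp add: P_tilde_def)

lemma integral_dens_P: "(\<integral>w. dens P w \<partial>ref_measure) = 1"
proof -
  have "1 = emeasure P (space P)"
    using prob_space.emeasure_space_1[OF prob_space_P] by simp
  also have "\<dots> = emeasure (density ref_measure (\<lambda>w. ennreal (dens P w))) (space ref_measure)"
    by (subst (1 2) P_eq) simp
  also have "\<dots> = (\<integral>\<^sup>+w. ennreal (dens P w) \<partial>ref_measure)"
    by (subst emeasure_density) (auto intro!: nn_integral_cong)
  also have "\<dots> = ennreal (\<integral>w. dens P w \<partial>ref_measure)"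
    by (intro nn_integral_eq_integral integrable_dens_P AE_I2) (simp add: space_ref_measure dens_P_nonneg)
  finally show ?thesis by (metis ennreal_eq_1)
qed

lemma prob_space_Q: "prob_space Q"
proof (rule prob_spaceI)
  have q: "q = (\<lambda>w. dens P w + of_int (snd w) * g (fst w))"
    by (simp add: q_def case_prod_beta')
  have "emeasure Q (space Q) = (\<integral>\<^sup>+w. ennreal (q w) \<partial>ref_measure)"
    unfolding Q_eq using measurable_q by (subst emeasure_density) (auto intro!: nn_integral_cong)
  also have "\<dots> = ennreal (\<integral>w. q w \<partial>ref_measure)"
    using integrable_dens_P integrable_signed_g
    by (intro nn_integral_eq_integral AE_I2) (auto simp: space_ref_measure q_nonneg, simp add: q)
  also have "(\<integral>w. q w \<partial>ref_measure) = 1"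
    using integrable_dens_P integrable_signed_g by (simp add: q integral_dens_P integral_signed_g)
  finally show "emeasure Q (space Q) = 1" by simp
qed

lemma Q_P_tilde: "Q \<in> P_tilde"
  using prob_space_Q is_C1_density_q by (auto simp: P_tilde_def)

lemma dens_Q:
  assumes "x \<in> {0..1}" "y \<in> {-1, 1}"
  shows "dens Q (x, y) = dens P (x, y) + of_int y * g x"
    "dens_deriv Q (x, y) = dens_deriv P (x, y) + of_int y * g' x"
  using dens_eqI[OF Q_P_tilde is_C1_density_q assms]
    dens_deriv_eqI[OF Q_P_tilde is_C1_density_q assms has_real_derivative_q[OF assms]]
  by (simp_all add: q_def)

lemma dens_diff_Q:
  assumes "x \<in> {0..1}"
  shows "dens_diff Q x = dens_diff P x + 2 * g x"
    "dens_diff_deriv Q x = dens_diff_deriv P x + 2 * g' x"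
  using assms by (simp_all add: dens_diff_def dens_diff_deriv_def dens_Q)

text \<open>The term \<open>4 * \<epsilon>\<close> comes from the slope of the bump and does not
  shrink with \<open>t\<close>; hence \<epsilon> itself has to be small compared with the radius of
  a ball inside the open set.\<close>

lemma C1_dist_Q: "C1_dist P Q \<le> \<epsilon> * t + 4 * \<epsilon>"
proof -
  have "(SUP w\<in>Omega. \<bar>dens P w - dens Q w\<bar>) \<le> \<epsilon> * t"
  proof (rule cSUP_least[OF Omega_nonempty])
    fix w assume "w \<in> Omega"
    moreover have "\<bar>g x\<bar> \<le> \<epsilon> * t" for x using g_bounds[of x] by simp
    ultimately show "\<bar>dens P w - dens Q w\<bar> \<le> \<epsilon> * t"
      by (auto simp: Omega_def dens_Q)
  qed
  moreover have "(SUP w\<in>Omega. \<bar>dens_deriv P w - dens_deriv Q w\<bar>) \<le> 4 * \<epsilon>"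
  proof (rule cSUP_least[OF Omega_nonempty])
    fix w assume "w \<in> Omega"
    then show "\<bar>dens_deriv P w - dens_deriv Q w\<bar> \<le> 4 * \<epsilon>"
      using g'_bound by (auto simp: Omega_def dens_Q)
  qed
  ultimately show ?thesis unfolding C1_dist_def by linarith
qed

text \<open>The perturbation changes the slope difference by at most
  \<open>8 * \<epsilon> \<le> D / 4\<close>.\<close>

lemma dens_diff_deriv_Q_bounds:
  assumes "\<bar>x - a\<bar> \<le> \<eta>"
  shows "D / 4 \<le> dens_diff_deriv Q x" "dens_diff_deriv Q x \<le> 3 * D"
  using D(1) D(2,3)[OF assms] dens_diff_Q(2)[of x] window_unit[OF assms] g'_bound[of x] eps
  by auto

lemma dens_diff_Q_increment:
  assumes "a - \<eta> \<le> x" "x \<le> z" "z \<le> a + \<eta>"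
  shows "D / 4 * (z - x) \<le> dens_diff Q z - dens_diff Q x"
    "dens_diff Q z - dens_diff Q x \<le> 3 * D * (z - x)"
proof -
  have "{x..z} \<subseteq> {0<..<1}" using assms by (intro subset_trans[OF _ window]) auto
  then show "D / 4 * (z - x) \<le> dens_diff Q z - dens_diff Q x"
    "dens_diff Q z - dens_diff Q x \<le> 3 * D * (z - x)"
    using dens_diff_increment[OF Q_P_tilde assms(2), of "D / 4" "3 * D"] dens_diff_deriv_Q_bounds assms
    by (auto simp: abs_le_iff)
qed

text \<open>The bump leaves the negative value at \<open>a - t\<close> unchanged and makes the value
  at \<open>a\<close> positive, which yields a zero in between. A second zero is impossible: within
  distance \<open>t\<close> of \<open>a\<close> the difference is strictly increasing, and further
  out it equals that of \<open>P\<close>, whose only zero is \<open>a\<close>.\<close>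

lemma crossing_Q:
  shows "\<exists>!b. crossing Q b" "crossing Q (cross_pt Q)" "a - t < cross_pt Q" "cross_pt Q < a"
proof -
  have I: "{a - t..a} \<subseteq> {0..1}" "a - t \<in> {0..1}" "a \<in> {0..1}"
    using window_unit[of "a - t"] window_unit[of a] t by auto
  have l: "dens_diff Q (a - t) < 0"
    using P_class_sign(2)[OF P I(2)] t I g_outside[of "a - t"] by (simp add: dens_diff_Q)
  have r: "0 < dens_diff Q a"
    using I t eps P_facts(3) by (simp add: dens_diff_Q g_center)
  obtain b where b: "a - t \<le> b" "b \<le> a" "dens_diff Q b = 0"
    using IVT'[of "dens_diff Q" "a - t" 0 a] l r t
      continuous_on_subset[OF continuous_on_dens_diff I(1)] by force
  have b_range: "a - t < b" "b < a" using b l r by (auto simp: le_less)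
  have uniq: "x = b" if x: "x \<in> {0..1}" "dens_diff Q x = 0" for x
  proof (cases "\<bar>x - a\<bar> \<le> t")
    case True
    then show ?thesis
      using dens_diff_Q_increment(1)[of b x] dens_diff_Q_increment(1)[of x b] b x D(1) t
      by (cases x b rule: linorder_cases) (auto simp: abs_le_iff mult_le_0_iff)
  next
    case False
    then have "dens_diff P x = 0" using dens_diff_Q(1)[OF x(1)] g_outside[of x] x by simp
    then have "x = a" using P_facts(5) x by blast
    then show ?thesis using False t by simp
  qed
  have cb: "crossing Q b" using b b_range I by (auto simp: crossing_iff)
  show ex: "\<exists>!b. crossing Q b" using cb uniq by (auto simp: crossing_iff)
  show c: "crossing Q (cross_pt Q)" using theI'[OF ex] by (simp add: cross_pt_def)
  then have "cross_pt Q = b" using uniq by (simp add: crossing_iff)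
  then show "a - t < cross_pt Q" "cross_pt Q < a" using b_range by auto
qed

lemma Q_P_class: "Q \<in> P_class"
proof -
  have w: "\<bar>cross_pt Q - a\<bar> \<le> \<eta>" using crossing_Q(3,4) t by auto
  have "0 < dens_diff_deriv Q (cross_pt Q)" using dens_diff_deriv_Q_bounds(1)[OF w] D(1) by simp
  then show ?thesis
    using Q_P_tilde crossing_Q(1) window_unit[OF w] by (simp add: P_class_def dens_diff_deriv_def)
qed

text \<open>In the expansion of the square the linear term integrates to 0. The quadratic term is at
  most \<open>(\<epsilon> * t)\<^sup>2 / m\<close> on an interval of length \<open>2 * t\<close>,
  once for each label.\<close>

lemma chi_square_Q: "(\<integral>\<^sup>+w. (ennreal (ratio w))\<^sup>2 \<partial>P) \<le> ennreal (1 + 4 * \<epsilon>\<^sup>2 / m * t ^ 3)"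
proof -
  let ?h = "\<lambda>w. (g (fst w))\<^sup>2 / dens P w"
  have h_bound: "\<bar>?h w\<bar> \<le> (\<epsilon> * t)\<^sup>2 / m" if "w \<in> Omega" for w
  proof -
    have "?h w \<le> (\<epsilon> * t)\<^sup>2 / m * indicator {a - t..a + t} (fst w)"
      using g_square_div_dens_le[of "fst w" "snd w"] that by simp
    also have "\<dots> \<le> (\<epsilon> * t)\<^sup>2 / m" using m by (auto simp: indicator_def)
    finally show ?thesis using dens_P_nonneg[OF that] by simp
  qed
  have int_h: "integrable ref_measure ?h"
    by (rule integrable_ref_bounded[OF _ h_bound]) measurable
  interpret R: prob_space unit_lborel by (rule prob_space_unit_lborel)
  have sub: "{a - t..a + t} \<subseteq> {0..1}"
    using window_unit[of "a - t"] window_unit[of "a + t"] t by auto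
  then have ind: "{a - t..a + t} \<in> sets unit_lborel" "measure unit_lborel {a - t..a + t} = 2 * t"
    using t by (auto simp: sets_restrict_space measure_restrict_space
        intro!: image_eqI[of _ _ "{a - t..a + t}"])
  have "(\<integral>w. ?h w \<partial>ref_measure) = (\<integral>x. (g x)\<^sup>2 / dens P (x, 1) + (g x)\<^sup>2 / dens P (x, -1) \<partial>unit_lborel)"
    by (simp add: integral_ref[OF int_h])
  also have "\<dots> \<le> (\<integral>x. 2 * ((\<epsilon> * t)\<^sup>2 / m) * indicator {a - t..a + t} x \<partial>unit_lborel)"
  proof (rule integral_mono')
    show "integrable unit_lborel (\<lambda>x. 2 * ((\<epsilon> * t)\<^sup>2 / m) * indicator {a - t..a + t} x)"
      using ind by (intro integrable_mult_right) (simp add: R.emeasure_eq_measure)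
    fix x assume "x \<in> space unit_lborel"
    then have "(x, 1) \<in> Omega" "(x, -1) \<in> Omega" by (auto simp: space_restrict_space Omega_def)
    from this[THEN g_square_div_dens_le] this[THEN dens_P_nonneg]
    show "(g x)\<^sup>2 / dens P (x, 1) + (g x)\<^sup>2 / dens P (x, -1)
        \<le> 2 * ((\<epsilon> * t)\<^sup>2 / m) * indicator {a - t..a + t} x"
      "0 \<le> 2 * ((\<epsilon> * t)\<^sup>2 / m) * indicator {a - t..a + t} x"
      using m(1) by auto
  qed
  also have "\<dots> = 2 * ((\<epsilon> * t)\<^sup>2 / m) * (2 * t)"
    using ind by (simp add: Int_absorb2[OF sub] del: Int_atLeastAtMost)
  also have "\<dots> = 4 * \<epsilon>\<^sup>2 / m * t ^ 3"
    by (simp add: power2_eq_square power3_eq_cube)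
  finally have le: "(\<integral>w. ?h w \<partial>ref_measure) \<le> 4 * \<epsilon>\<^sup>2 / m * t ^ 3" .
  let ?k = "\<lambda>w. dens P w + 2 * (of_int (snd w) * g (fst w)) + ?h w"
  have int_k: "integrable ref_measure ?k"
    by (intro Bochner_Integration.integrable_add integrable_mult_right integrable_dens_P
        integrable_signed_g int_h)
  have "(\<integral>\<^sup>+w. (ennreal (ratio w))\<^sup>2 \<partial>P)
      = (\<integral>\<^sup>+w. (ennreal (ratio w))\<^sup>2 \<partial>density ref_measure (\<lambda>w. ennreal (dens P w)))"
    using P_eq by simp
  also have "\<dots> = (\<integral>\<^sup>+w. ennreal (dens P w) * (ennreal (ratio w))\<^sup>2 \<partial>ref_measure)"
    by (rule nn_integral_density) measurable
  also have "\<dots> = (\<integral>\<^sup>+w. ennreal (?k w) \<partial>ref_measure)"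
    by (intro nn_integral_cong)
      (simp add: space_ref_measure ratio_nonneg dens_P_nonneg ennreal_power
        flip: ennreal_mult dens_ratio(2))
  also have "\<dots> = ennreal (\<integral>w. ?k w \<partial>ref_measure)"
    by (intro nn_integral_eq_integral int_k AE_I2)
      (simp add: space_ref_measure dens_P_nonneg flip: dens_ratio(2))
  also have "(\<integral>w. ?k w \<partial>ref_measure) = 1 + (\<integral>w. ?h w \<partial>ref_measure)"
    using integrable_dens_P integrable_signed_g int_h
    by (simp add: integral_dens_P integral_signed_g)
  also have "ennreal \<dots> \<le> ennreal (1 + 4 * \<epsilon>\<^sup>2 / m * t ^ 3)"
    using le by (intro ennreal_leI) simp
  finally show ?thesis .
qed

text \<open>The optimal thresholds of \<open>P\<close> and \<open>Q\<close> are of order \<open>t\<close> apart, so that no threshold is good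
  for both; the midpoint decides for which one it is bad.\<close>

lemma pred_error_separation:
  obtains c where
    "\<And>\<alpha>. \<alpha> < c \<Longrightarrow> pred_error P a + \<epsilon>\<^sup>2 / (512 * D) * t\<^sup>2 < pred_error P \<alpha>"
    "\<And>\<alpha>. c \<le> \<alpha> \<Longrightarrow> pred_error Q (cross_pt Q) + \<epsilon>\<^sup>2 / (512 * D) * t\<^sup>2 < pred_error Q \<alpha>"
proof
  define b where "b = cross_pt Q"
  define c where "c = (a + b) / 2"
  define w where "w = a - b"
  have b: "a - t < b" "b < a" using crossing_Q by (auto simp: b_def)
  have w: "0 < w" using b by (simp add: w_def)
  \<comment> \<open>The points that cut the interval from \<open>b\<close> to \<open>a\<close> into
    quarters: on the quarter next to \<open>c\<close>, on either side, the distance to the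
    respective optimum is at least \<open>w / 4\<close>.\<close>
  have c: "b < (b + c) / 2" "(b + c) / 2 < c" "c < (c + a) / 2" "(c + a) / 2 < a"
    using b by (simp_all add: c_def field_simps)
  have ab: "a \<in> {0..1}" "b \<in> {0..1}" "\<bar>b - a\<bar> \<le> \<eta>"
    using window_unit[of a] window_unit[of b] b t by auto
  have Qb: "dens_diff Q b = 0" using crossing_Q(2) by (simp add: b_def crossing_iff)
  \<comment> \<open>Between \<open>b\<close> and \<open>a\<close> the difference for
    \<open>Q\<close> climbs from 0 to twice the bump height with slope at most \<open>3 * D\<close>,
    so \<open>w\<close> cannot be short.\<close>
  have "2 * (\<epsilon> * t) = dens_diff Q a - dens_diff Q b"
    using ab(1) Qb P_facts(3) by (simp add: dens_diff_Q g_center)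
  also have "\<dots> \<le> 3 * D * w"
    unfolding w_def using b t by (intro dens_diff_Q_increment) auto
  finally have "\<epsilon> * t \<le> 2 * (D * w)" using mult_pos_pos[OF D(1) w] eps t by simp
  then have "\<epsilon> * t / (2 * D) \<le> w" using D(1) by (simp add: field_simps)
  then have "(\<epsilon> * t / (2 * D))\<^sup>2 \<le> w\<^sup>2" using D(1) eps t by (intro power_mono) auto
  then have "D / 64 * (\<epsilon> * t / (2 * D))\<^sup>2 \<le> D / 64 * w\<^sup>2" using D(1) by (intro mult_left_mono) auto
  \<comment> \<open>The right side equals \<open>\<epsilon>\<^sup>2 / (256 * D) * t\<^sup>2\<close>;
    the spare factor 2 makes the inequality strict.\<close>
  moreover have "\<epsilon>\<^sup>2 / (512 * D) * t\<^sup>2 < D / 64 * (\<epsilon> * t / (2 * D))\<^sup>2"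
    using D(1) eps t by (simp add: field_simps power2_eq_square)
  ultimately have K: "\<epsilon>\<^sup>2 / (512 * D) * t\<^sup>2 < D / 64 * w\<^sup>2" by linarith
  show "pred_error P a + \<epsilon>\<^sup>2 / (512 * D) * t\<^sup>2 < pred_error P \<alpha>" if \<alpha>: "\<alpha> < c" for \<alpha>
  proof -
    \<comment> \<open>Slope at least \<open>D / 2\<close> over distance \<open>w / 4\<close> gives a
      gap of \<open>D / 8 * w\<close>, integrated over a quarter of length
      \<open>w / 4\<close>.\<close>
    have "2 * (D / 64 * w\<^sup>2) = D / 8 * w * ((c + a) / 2 - c)"
      by (simp add: c_def w_def field_simps power2_eq_square)
    also have "\<dots> \<le> - 1 * (pred_error P a - pred_error P \<alpha>)"
    proof (rule pred_error_gap[OF dens_P])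
      show "0 \<le> - 1 * (dens P (x, 1) - dens P (x, -1))" if "x \<in> {0..1}" "x < a" for x
        using P_class_sign(2)[OF P that] by (simp add: dens_diff_def)
      show "D / 8 * w \<le> - 1 * (dens P (x, 1) - dens P (x, -1))"
        if x: "c \<le> x" "x < (c + a) / 2" for x
      proof -
        have "D / 8 * w \<le> D / 2 * (a - x)"
          using mult_left_mono[of "w / 4" "a - x" "D / 2"] x D(1) by (simp add: w_def c_def field_simps)
        also have "\<dots> \<le> dens_diff P a - dens_diff P x"
        proof (rule dens_diff_increment(1)[OF P_facts(1)])
          show "x \<le> a" "{x..a} \<subseteq> {0<..<1}"
            using x c ab P_facts(2) by auto
          show "D / 2 \<le> dens_diff_deriv P s" "dens_diff_deriv P s \<le> 2 * D" if "s \<in> {x..a}" for s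
          proof -
            have "\<bar>s - a\<bar> \<le> \<eta>" using that x b c t by (simp add: abs_le_iff)
            then show "D / 2 \<le> dens_diff_deriv P s" "dens_diff_deriv P s \<le> 2 * D" by (rule D)+
          qed
        qed
        finally show ?thesis using P_facts(3) by (simp add: dens_diff_def)
      qed
    qed (use \<alpha> b c ab in auto)
    also have "\<dots> = pred_error P \<alpha> - pred_error P a" by simp
    finally have "2 * (D / 64 * w\<^sup>2) \<le> pred_error P \<alpha> - pred_error P a" .
    moreover have "0 < D / 64 * w\<^sup>2" using D(1) w by simp
    ultimately show ?thesis using K by linarith
  qed
  show "pred_error Q (cross_pt Q) + \<epsilon>\<^sup>2 / (512 * D) * t\<^sup>2 < pred_error Q \<alpha>" if \<alpha>: "c \<le> \<alpha>" for \<alpha>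
  proof -
    \<comment> \<open>The same for \<open>Q\<close>, whose slope is only known to be at least
      \<open>D / 4\<close>.\<close>
    have "D / 64 * w\<^sup>2 = D / 16 * w * (c - (b + c) / 2)"
      by (simp add: c_def w_def field_simps power2_eq_square)
    also have "\<dots> \<le> 1 * (pred_error Q \<alpha> - pred_error Q b)"
    proof (rule pred_error_gap[OF is_C1_density_dens[OF Q_P_tilde]])
      show "0 \<le> 1 * (dens Q (x, 1) - dens Q (x, -1))" if "x \<in> {0..1}" "b \<le> x" for x
        using P_class_sign(1)[OF Q_P_class that(1)] that(2) Qb unfolding b_def[symmetric]
        by (cases "x = b") (auto simp: dens_diff_def)
      show "D / 16 * w \<le> 1 * (dens Q (x, 1) - dens Q (x, -1))"
        if x: "(b + c) / 2 \<le> x" "x < c" for x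
      proof -
        have "D / 16 * w \<le> D / 4 * (x - b)"
          using mult_left_mono[of "w / 4" "x - b" "D / 4"] x D(1) by (simp add: w_def c_def field_simps)
        also have "\<dots> \<le> dens_diff Q x - dens_diff Q b"
          using x b c t by (intro dens_diff_Q_increment) auto
        finally show ?thesis using Qb by (simp add: dens_diff_def)
      qed
    qed (use \<alpha> b c ab in auto)
    also have "\<dots> = pred_error Q \<alpha> - pred_error Q (cross_pt Q)" by (simp add: b_def)
    finally show ?thesis using K by linarith
  qed
qed

end

text \<open>All local conditions hold near the crossing point by continuity. The scale \<epsilon> is
  fixed by \<open>P\<close> and \<open>r\<close> before \<open>t\<close>, so \<open>t\<close> may
  tend to 0 with the other parameters held constant.\<close>

lemma exists_perturbed_class:
  assumes P: "P \<in> P_class" and r: "0 < r"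
  obtains \<eta> m D \<epsilon> t0 where "0 < m" "0 < D" "0 < \<epsilon>" "0 < t0"
    "\<And>t. \<lbrakk>0 < t; t < t0\<rbrakk> \<Longrightarrow> perturbed_class P \<eta> m D \<epsilon> t"
    "\<And>t. \<lbrakk>0 < t; t < t0\<rbrakk> \<Longrightarrow> \<epsilon> * t + 4 * \<epsilon> < r"
proof -
  define a where "a = cross_pt P"
  define m where "m = min (dens P (a, 1)) (dens P (a, -1)) / 2"
  define D where "D = dens_diff_deriv P a"
  \<comment> \<open>With \<open>r / 8\<close> the slope part of the distance is at most
    \<open>r / 2\<close>; since \<open>t < 1\<close>, the height part adds at most
    \<open>r / 8\<close>.\<close>
  define \<epsilon> where "\<epsilon> = min (D / 32) (r / 8)"
  note F = P_classD[OF P, folded a_def]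
  have m: "0 < m" using dens_cross_pt_pos[OF P] by (simp add: m_def a_def)
  have D: "0 < D" using F(4) by (simp add: D_def)
  have eps: "0 < \<epsilon>" using D r by (simp add: \<epsilon>_def)
  have lim: "(f \<longlongrightarrow> f a) (nhds a)" if "continuous_on {0..1} f" for f :: "real \<Rightarrow> real"
    using continuous_on_interior[OF that, of a] F(2)
    by (simp add: interior_atLeastAtMost_real isCont_def flip: tendsto_at_iff_tendsto_nhds)
  have "\<forall>\<^sub>F x in nhds a. x \<in> {0<..<1} \<and> m < dens P (x, 1) \<and> m < dens P (x, -1)
      \<and> D / 2 < dens_diff_deriv P x \<and> dens_diff_deriv P x < 2 * D"
  proof (intro eventually_conj)
    show "\<forall>\<^sub>F x in nhds a. x \<in> {0<..<1}"
      using F(2) by (intro eventually_nhds_in_open) auto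
    have "\<forall>\<^sub>F x in nhds a. m < dens P (x, y)" if "y \<in> {-1, 1}" for y
    proof (rule order_tendstoD(1))
      show "((\<lambda>x. dens P (x, y)) \<longlongrightarrow> dens P (a, y)) (nhds a)"
        by (rule lim[OF dens_deriv_continuous(1)[OF that]])
      show "m < dens P (a, y)"
        using dens_cross_pt_pos[OF P, folded a_def, of 1] dens_cross_pt_pos[OF P, folded a_def, of "-1"] that
        by (auto simp: m_def)
    qed
    then show "\<forall>\<^sub>F x in nhds a. m < dens P (x, 1)" "\<forall>\<^sub>F x in nhds a. m < dens P (x, -1)"
      by simp_all
    have "(dens_diff_deriv P \<longlongrightarrow> D) (nhds a)"
      unfolding D_def by (rule lim[OF continuous_on_dens_diff_deriv])
    then show "\<forall>\<^sub>F x in nhds a. D / 2 < dens_diff_deriv P x"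
      "\<forall>\<^sub>F x in nhds a. dens_diff_deriv P x < 2 * D"
      using D by - (rule order_tendstoD[of _ D]; simp)+
  qed
  then obtain e where e: "0 < e" and near: "\<And>x. dist x a < e \<Longrightarrow> x \<in> {0<..<1} \<and> m < dens P (x, 1)
      \<and> m < dens P (x, -1) \<and> D / 2 < dens_diff_deriv P x \<and> dens_diff_deriv P x < 2 * D"
    unfolding eventually_nhds_metric by blast
  define \<eta> where "\<eta> = e / 2"
  have near': "x \<in> {0<..<1} \<and> m < dens P (x, 1) \<and> m < dens P (x, -1)
      \<and> D / 2 < dens_diff_deriv P x \<and> dens_diff_deriv P x < 2 * D" if "\<bar>x - a\<bar> \<le> \<eta>" for x
    using that e by (intro near) (auto simp: \<eta>_def dist_real_def)
  \<comment> \<open>The three bounds serve the distance, the window and the height of the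
    bump.\<close>
  define t0 where "t0 = min 1 (min \<eta> (m / \<epsilon>))"
  have t0: "0 < t0" using e m eps by (simp add: t0_def \<eta>_def)
  show thesis
  proof
    show "0 < m" "0 < D" "0 < \<epsilon>" "0 < t0" by fact+
    fix t assume t: "0 < t" "t < t0"
    have "\<epsilon> * t \<le> \<epsilon> * 1" using t eps by (intro mult_left_mono) (auto simp: t0_def)
    moreover have "\<epsilon> \<le> r / 8" by (simp add: \<epsilon>_def)
    ultimately show "\<epsilon> * t + 4 * \<epsilon> < r" using r by linarith
    show "perturbed_class P \<eta> m D \<epsilon> t"
    proof
      show "{cross_pt P - \<eta>..cross_pt P + \<eta>} \<subseteq> {0<..<1}"
        using near' unfolding a_def[symmetric] by (auto simp: abs_le_iff)
      show "m \<le> dens P (x, y)" if "\<bar>x - cross_pt P\<bar> \<le> \<eta>" "y \<in> {-1, 1}" for x y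
        using near'[of x] that by (auto simp: a_def)
      show "D / 2 \<le> dens_diff_deriv P x" "dens_diff_deriv P x \<le> 2 * D"
        if "\<bar>x - cross_pt P\<bar> \<le> \<eta>" for x
        using near'[of x] that by (auto simp: a_def)
      show "\<epsilon> \<le> D / 32" by (simp add: \<epsilon>_def)
      show "\<epsilon> * t \<le> m" using t eps by (simp add: t0_def field_simps)
      show "t \<le> \<eta>" using t by (simp add: t0_def)
    qed (use P m D eps t in auto)
  qed
qed

subsection \<open>The minimax lower bound\<close>

lemma npower_sets_cong: "sets M = sets N \<Longrightarrow> sets (npower n M) = sets (npower n N)"
  unfolding npower_def by (intro sets_PiM_cong) auto

lemma measurable_excess:
  assumes P: "P \<in> P_tilde" and ah: "estimator n ah"
  shows "{w \<in> space (npower n P). pred_error P (ah w) > s} \<in> sets (npower n P)"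
proof -
  have "sets P = sets ref_measure"
    using is_C1_density_dens[OF P] unfolding is_C1_density_def by (metis sets_density)
  then have "ah \<in> borel_measurable (npower n P)"
    using ah measurable_cong_sets[OF npower_sets_cong refl] unfolding estimator_def by blast
  then have [measurable]: "(\<lambda>w. pred_error P (ah w)) \<in> borel_measurable (npower n P)"
    using borel_measurable_pred_error[OF is_C1_density_dens[OF P]] by (rule measurable_compose)
  show ?thesis by measurable
qed

context perturbed_class
begin

text \<open>The estimator is turned into a test by asking on which side of \<open>c\<close> it
  falls; a wrong answer under either law costs the excess error of
  \<open>pred_error_separation\<close>.\<close>

lemma minimax_two_point:
  assumes ah: "estimator n ah" and S: "S \<le> \<epsilon>\<^sup>2 / (512 * D) * t\<^sup>2"
    and \<delta>: "0 \<le> \<delta>" "\<delta> \<le> 1" "\<delta> * (1 + 4 * \<epsilon>\<^sup>2 / m * t ^ 3) ^ n \<le> (1 - \<delta>)\<^sup>2"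
  shows "\<exists>R\<in>{P, Q}. \<delta> \<le> measure (npower n R)
    {w \<in> space (npower n R). pred_error R (ah w) > pred_error R (cross_pt R) + S}"
proof -
  obtain c where
    cP: "\<And>\<alpha>. \<alpha> < c \<Longrightarrow> pred_error P a + \<epsilon>\<^sup>2 / (512 * D) * t\<^sup>2 < pred_error P \<alpha>" and
    cQ: "\<And>\<alpha>. c \<le> \<alpha> \<Longrightarrow> pred_error Q (cross_pt Q) + \<epsilon>\<^sup>2 / (512 * D) * t\<^sup>2 < pred_error Q \<alpha>"
    using pred_error_separation by blast
  define E where "E = {w \<in> space (npower n P). ah w < c}"
  have sets_P: "sets P = sets ref_measure" by (subst P_eq) simp
  have sets_Q: "sets Q = sets P" by (simp add: Q_def)
  have [measurable]: "ah \<in> borel_measurable (npower n P)"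
    using ah measurable_cong_sets[OF npower_sets_cong[OF sets_P] refl] unfolding estimator_def by blast
  have space_Q: "space (npower n Q) = space (npower n P)"
    by (rule sets_eq_imp_space_eq[OF npower_sets_cong[OF sets_Q]])
  have "\<delta> \<le> measure (npower n P) E \<or>
    \<delta> \<le> measure (npower n (density P (\<lambda>w. ennreal (ratio w)))) (space (npower n P) - E)"
  proof (rule two_point_test)
    show "(\<lambda>w. ennreal (ratio w)) \<in> borel_measurable P"
      unfolding measurable_cong_sets[OF sets_P refl] by measurable
    show "prob_space P" "prob_space (density P (\<lambda>w. ennreal (ratio w)))"
      using prob_space_P prob_space_Q by (simp_all add: Q_def)
    show "E \<in> sets (npower n P)" unfolding E_def by measurable
    show "0 \<le> 4 * \<epsilon>\<^sup>2 / m * t ^ 3" using m(1) t by simp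
  qed (use chi_square_Q \<delta> in auto)
  then consider "\<delta> \<le> measure (npower n P) E" | "\<delta> \<le> measure (npower n Q) (space (npower n P) - E)"
    by (auto simp: Q_def)
  then show ?thesis
  proof cases
    case 1
    interpret Pn: prob_space "npower n P" by (rule prob_space_npower[OF prob_space_P])
    have "measure (npower n P) E
        \<le> measure (npower n P) {w \<in> space (npower n P). pred_error P (ah w) > pred_error P a + S}"
      by (rule Pn.finite_measure_mono[OF _ measurable_excess[OF P_facts(1) ah]])
        (use cP S in \<open>force simp: E_def\<close>)
    then show ?thesis using 1 by auto
  next
    case 2
    interpret Qn: prob_space "npower n Q" by (rule prob_space_npower[OF prob_space_Q])
    have "measure (npower n Q) (space (npower n P) - E)
        \<le> measure (npower n Q)
            {w \<in> space (npower n Q). pred_error Q (ah w) > pred_error Q (cross_pt Q) + S}"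
      by (rule Qn.finite_measure_mono[OF _ measurable_excess[OF Q_P_tilde ah]])
        (use cQ S in \<open>force simp: E_def space_Q not_less\<close>)
    then show ?thesis using 2 by auto
  qed
qed

end

text \<open>This matches the second moment to the level. For \<open>\<delta> < 1 / 11\<close> the
  exponential of the logarithmic term is \<open>1 / (11 * \<delta>)\<close>, otherwise it is at most
  11/4; both fit because \<open>(1 - \<delta>)\<^sup>2 \<ge> 9 / 16\<close>.\<close>

lemma test_level_bound:
  fixes \<delta> :: real
  assumes \<delta>: "0 < \<delta>" "\<delta> \<le> 1 / 4"
  shows "\<delta> * exp (max \<bar>ln (11 * \<delta>)\<bar> 1 / 2) \<le> (1 - \<delta>)\<^sup>2"
proof -
  define l where "l = \<bar>ln (11 * \<delta>)\<bar>"
  have sq: "(3 / 4)\<^sup>2 \<le> (1 - \<delta>)\<^sup>2" using \<delta> by (intro power_mono) auto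
  \<comment> \<open>Comparing squares removes the factor 1/2 in the exponent.\<close>
  have "exp (max l 1 / 2) \<le> (1 - \<delta>)\<^sup>2 / \<delta>"
  proof (rule power2_le_imp_le)
    have "(3 / 4)\<^sup>2 / (1 / 4) \<le> (1 - \<delta>)\<^sup>2 / \<delta>" using sq \<delta> by (intro frac_le) auto
    then have big: "9 / 4 \<le> (1 - \<delta>)\<^sup>2 / \<delta>" by (simp add: power2_eq_square)
    then have "(9 / 4)\<^sup>2 \<le> ((1 - \<delta>)\<^sup>2 / \<delta>)\<^sup>2" by (intro power_mono) auto
    \<comment> \<open>The value 5 exceeds both 11/4 and \<open>exp 1\<close>.\<close>
    moreover have "5 \<le> (9 / 4 :: real)\<^sup>2" by (simp add: power2_eq_square)
    ultimately have sq5: "5 \<le> ((1 - \<delta>)\<^sup>2 / \<delta>)\<^sup>2" by linarith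
    have "exp l \<le> ((1 - \<delta>)\<^sup>2 / \<delta>)\<^sup>2"
    proof (cases "1 \<le> 11 * \<delta>")
      case True
      then have "exp l = 11 * \<delta>" using \<delta> by (simp add: l_def)
      then show ?thesis using \<delta> sq5 by linarith
    next
      case False
      then have "ln (11 * \<delta>) < 0" using \<delta> by simp
      then have "exp l = 1 / (11 * \<delta>)" using \<delta> by (simp add: l_def exp_minus inverse_eq_divide)
      also have "\<dots> \<le> (1 - \<delta>)\<^sup>2 / \<delta>" using sq \<delta> by (simp add: field_simps power2_eq_square)
      also have "\<dots> \<le> ((1 - \<delta>)\<^sup>2 / \<delta>)\<^sup>2" using big by (intro self_le_power) linarith+
      finally show ?thesis .
    qed
    moreover have "exp 1 \<le> ((1 - \<delta>)\<^sup>2 / \<delta>)\<^sup>2" using exp_le sq5 by linarith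
    ultimately have "exp (max l 1) \<le> ((1 - \<delta>)\<^sup>2 / \<delta>)\<^sup>2" by (simp add: max_def)
    then show "(exp (max l 1 / 2))\<^sup>2 \<le> ((1 - \<delta>)\<^sup>2 / \<delta>)\<^sup>2"
      by (simp flip: exp_double)
  qed (use \<delta> in auto)
  then show ?thesis using \<delta> by (simp add: l_def field_simps)
qed

theorem corollary1p4:
  fixes U :: "(real \<times> int) measure set"
  assumes "openin P_topology U" and "U \<noteq> {}"
  shows "\<exists>c2 > 0. \<forall>\<delta> \<in> {0<..1/4}. \<forall>ah :: nat \<Rightarrow> (nat \<Rightarrow> real \<times> int) \<Rightarrow> real.
    (\<forall>n. estimator n (ah n)) \<longrightarrow>
    (let S = c2 * \<bar>ln (11 * \<delta>)\<bar> powr (2/3) in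
     liminf (\<lambda>n. SUP P\<in>U. ereal (measure (npower n P)
        {w \<in> space (npower n P).
          pred_error P (ah n w) > pred_error P (cross_pt P) + S * real n powr (-2/3)}))
     \<ge> ereal \<delta>)"
proof -
  obtain P where PU: "P \<in> U" using assms(2) by blast
  then have P: "P \<in> P_class" using assms(1) by (auto simp: openin_P_topology)
  obtain r where r: "0 < r" and ball: "\<And>Q. \<lbrakk>Q \<in> P_class; C1_dist P Q < r\<rbrakk> \<Longrightarrow> Q \<in> U"
  proof -
    have "\<exists>r>0. \<forall>Q\<in>P_class. C1_dist P Q < r \<longrightarrow> Q \<in> U"
      using assms(1) PU unfolding openin_P_topology by simp
    then show ?thesis using that by metis
  qed
  obtain \<eta> m D \<epsilon> t0 where pos: "0 < m" "0 < D" "0 < \<epsilon>" "0 < t0"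
    and pert: "\<And>t. \<lbrakk>0 < t; t < t0\<rbrakk> \<Longrightarrow> perturbed_class P \<eta> m D \<epsilon> t"
    and close: "\<And>t. \<lbrakk>0 < t; t < t0\<rbrakk> \<Longrightarrow> \<epsilon> * t + 4 * \<epsilon> < r"
    by (rule exists_perturbed_class[OF P r]) (rule that)
  \<comment> \<open>\<open>C\<close> is the chi-square constant and \<open>K\<close> the separation
    constant; neither depends on \<delta>.\<close>
  define C where "C = 4 * \<epsilon>\<^sup>2 / m"
  define K where "K = \<epsilon>\<^sup>2 / (512 * D)"
  have CK: "0 < C" "0 < K" using pos by (auto simp: C_def K_def)
  \<comment> \<open>Chosen so that \<open>S = K * (l / (2 * C)) powr (2/3)\<close>, which \<tau>
    below dominates.\<close>
  define c2 where "c2 = K / (2 * C) powr (2/3)"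
  show ?thesis
  proof (intro exI[of _ c2] conjI ballI allI impI)
    show "0 < c2" using CK by (simp add: c2_def)
    fix \<delta> :: real and ah :: "nat \<Rightarrow> (nat \<Rightarrow> real \<times> int) \<Rightarrow> real"
    assume \<delta>: "\<delta> \<in> {0<..1/4}" and ah: "\<forall>n. estimator n (ah n)"
    define l where "l = \<bar>ln (11 * \<delta>)\<bar>"
    define S where "S = c2 * l powr (2/3)"
    \<comment> \<open>The solution of \<open>C * \<tau> ^ 3 = max l 1 / 2\<close>. The maximum keeps
      \<tau> positive when \<open>l = 0\<close>, that is at
      \<open>\<delta> = 1 / 11\<close>.\<close>
    define \<tau> where "\<tau> = (max l 1 / (2 * C)) powr (1/3)"
    have \<tau>: "0 < \<tau>" using CK by (simp add: \<tau>_def)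
    have \<tau>3: "C * \<tau> ^ 3 = max l 1 / 2"
      using CK by (simp add: \<tau>_def powr_power)
    have "S = K * (l / (2 * C)) powr (2/3)"
      using CK by (simp add: S_def c2_def powr_divide l_def)
    also have "\<dots> \<le> K * (max l 1 / (2 * C)) powr (2/3)"
      using CK by (intro mult_left_mono powr_mono2 divide_right_mono) (auto simp: l_def)
    also have "\<dots> = K * \<tau>\<^sup>2"
      using CK by (simp add: \<tau>_def powr_power)
    finally have S: "S \<le> K * \<tau>\<^sup>2" .
    \<comment> \<open>At this rate \<open>n * C * t ^ 3\<close> stays constant, while the separation
      \<open>K * t\<^sup>2\<close> has order \<open>n powr (-2/3)\<close>.\<close>
    define t where "t = (\<lambda>n::nat. \<tau> * real n powr (-1/3))"
    have "(\<lambda>n. \<tau> * real n powr (-1/3)) \<longlonglongrightarrow> \<tau> * 0"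
      by (intro tendsto_mult tendsto_const tendsto_neg_powr filterlim_real_sequentially) simp
    then have "t \<longlonglongrightarrow> 0" by (simp add: t_def)
    then have "\<forall>\<^sub>F n in sequentially. t n < t0" using pos(4) by (rule order_tendstoD)
    \<comment> \<open>At \<open>n = 0\<close> the convention \<open>0 powr x = 0\<close> would make
      the width vanish.\<close>
    with eventually_gt_at_top[of 0]
    have "\<forall>\<^sub>F n in sequentially. ereal \<delta> \<le> (SUP P\<in>U. ereal (measure (npower n P)
        {w \<in> space (npower n P).
          pred_error P (ah n w) > pred_error P (cross_pt P) + S * real n powr (-2/3)}))"
    proof eventually_elim
      case (elim n)
      have tpos: "0 < t n" using elim \<tau> by (simp add: t_def)
      interpret perturbed_class P \<eta> m D \<epsilon> "t n" by (rule pert[OF tpos elim(2)])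
      have "Q \<in> U" using ball[OF Q_P_class] C1_dist_Q close[OF tpos elim(2)] by linarith
      have "S * real n powr (-2/3) \<le> K * \<tau>\<^sup>2 * real n powr (-2/3)"
        using S by (intro mult_right_mono) auto
      also have "\<dots> = \<epsilon>\<^sup>2 / (512 * D) * (t n)\<^sup>2"
        using elim by (simp add: K_def t_def power_mult_distrib powr_power)
      finally have S_le: "S * real n powr (-2/3) \<le> \<epsilon>\<^sup>2 / (512 * D) * (t n)\<^sup>2" .
      have "(real n powr (-1/3)) ^ 3 = 1 / n"
        using elim by (subst powr_power) (auto simp: powr_minus_divide)
      then have cube: "(t n) ^ 3 = \<tau> ^ 3 / n"
        by (simp only: t_def power_mult_distrib times_divide_eq_right mult_1_right)
      have eq: "4 * \<epsilon>\<^sup>2 / m * t n ^ 3 = max l 1 / 2 / n"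
        using \<tau>3 by (simp only: C_def cube times_divide_eq_right)
      \<comment> \<open>The inequality \<open>1 + x \<le> exp x\<close> bounds the
        \<open>n\<close>-fold second moment uniformly in \<open>n\<close>.\<close>
      have "(1 + 4 * \<epsilon>\<^sup>2 / m * t n ^ 3) ^ n \<le> exp (max l 1 / 2 / n) ^ n"
        unfolding eq by (intro power_mono exp_ge_add_one_self add_nonneg_nonneg) auto
      also have "\<dots> = exp (max l 1 / 2)"
        using elim by (simp flip: exp_of_nat_mult)
      finally have "\<delta> * (1 + 4 * \<epsilon>\<^sup>2 / m * t n ^ 3) ^ n \<le> \<delta> * exp (max l 1 / 2)"
        using \<delta> by (intro mult_left_mono) auto
      also have "\<dots> \<le> (1 - \<delta>)\<^sup>2"
        using test_level_bound[of \<delta>] \<delta> by (simp add: l_def)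
      finally have level: "\<delta> * (1 + 4 * \<epsilon>\<^sup>2 / m * t n ^ 3) ^ n \<le> (1 - \<delta>)\<^sup>2" .
      have "0 \<le> \<delta>" "\<delta> \<le> 1" using \<delta> by auto
      from minimax_two_point[OF _ S_le this level] ah
      obtain R where R: "R \<in> {P, Q}" "\<delta> \<le> measure (npower n R)
          {w \<in> space (npower n R). pred_error R (ah n w) > pred_error R (cross_pt R) + S * real n powr (-2/3)}"
        by blast
      have "R \<in> U" using R(1) PU \<open>Q \<in> U\<close> by auto
      then show ?case
        by (rule SUP_upper2) (simp only: ereal_less_eq R(2))
    qed
    then show "let S = c2 * \<bar>ln (11 * \<delta>)\<bar> powr (2/3) in
      ereal \<delta> \<le> liminf (\<lambda>n. SUP P\<in>U. ereal (measure (npower n P)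
        {w \<in> space (npower n P).
          pred_error P (ah n w) > pred_error P (cross_pt P) + S * real n powr (-2/3)}))"
      unfolding Let_def l_def[symmetric] S_def[symmetric] by (rule Liminf_bounded)
  qed
qed

end
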